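(* Let $G=(V,E,\mathcal{P},(V_\Diamond,V_\square))$ be a parity game and let $\overline{\rho}$ be the least game parity progress measure of $G$. Then for every vertex $v\in V$: (1) there is a (possibly history-dependent) strategy $\sigma_\square$ for player $\square$ such that every play $\pi$ starting in $v$ and consistent with $\sigma_\square$ satisfies $\theta_\Diamond(\pi)\geq \overline{\rho}(v)$; (2) there is a positional strategy $\sigma_\Diamond$ for player $\Diamond$ such that every play $\pi$ starting in $v$ and consistent with $\sigma_\Diamond$ satisfies $\theta_\Diamond(\pi)\leq \overline{\rho}(v)$.
   Context: A parity game $G=(V,E,\mathcal{P},(V_\Diamond,V_\square))$ consists of a finite set $V$ of vertices partitioned into $V_\Diamond$ (owned by player even, $\Diamond$) and $V_\square$ (owned by player odd, $\square$), a total edge relation $E\subseteq V\times V$ (every vertex has a successor), and a priority function $\mathcal{P}:V\to\mathbb{N}$. Write $v^\bullet=\{w\mid (v,w)\in E\}$ and $V_i=\{v\mid \mathcal{P}(v)=i\}$. A play is an infinite path $\pi=\pi_0\pi_1\cdots$ in which the owner of the current vertex chooses the next vertex; $\Diamond$ wins the play iff the least priority occurring infinitely often is even, otherwise $\square$ wins. A strategy for player $i$ is a partial function $\sigma:V^+\to V$ defined on finite paths ending in $V_i$ and choosing a successor of the last vertex; it is positional if it depends only on the last vertex. A play is consistent with $\sigma$ if every move made at a prefix on which $\sigma$ is defined is the one prescribed by $\sigma$. Let $d$ be one more than the largest priority in $G$. Tuples $\alpha=(\alpha_0,\dots,\alpha_{d-1})\in\mathbb{N}^d$ are ordered lexicographically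 by $<$; $\alpha<_i\beta$ means $(\alpha_0,\dots,\alpha_i)<(\beta_0,\dots,\beta_i)$ lexicographically, and $\alpha=_i\beta$ means they agree on positions $0,\dots,i$ ($\geq_i$ etc. derived accordingly). Let $\mathbb{M}^\Diamond$ consist of a top element $\top\notin\mathbb{N}^d$ together with all $d$-tuples having $0$ at every even position and a natural number $\le |V_i|$ at every odd position $i$; $\alpha<\top$ for all tuples $\alpha$ (also for each $<_i$), and $\top=\top$. For $\rho:V\to\mathbb{M}^\Diamond$ and $w\in v^\bullet$, $\mathrm{Prog}(\rho,v,w)$ is the least $m\in\mathbb{M}^\Diamond$ such that $m\geq_{\mathcal{P}(v)}\rho(w)$ if $\mathcal{P}(v)$ is even, and $m>_{\mathcal{P}(v)}\rho(w)$ or $m=\rho(w)=\top$ if $\mathcal{P}(v)$ is odd. $\rho$ is a game parity progress measure if for every $v\in V_\Diamond$ there is $w\in v^\bullet$ with $\rho(v)\geq_{\mathcal{P}(v)}\mathrm{Prog}(\rho,v,w)$, and for every $v\in V_\square$ and all $w\in v^\bullet$, $\rho(v)\geq_{\mathcal{P}(v)}\mathrm{Prog}(\rho,v,w)$. Measures are ordered pointwise; the least game parity progress measure is the least such $\rho$. Let $\mathbb{M}^\Diamond_{ext}$ consist of $\top$ and all tuples in $\mathbb{N}^d$ with $0$ at even positions (no upper bound at odd positions), ordered as $\mathbb{M}^\Diamond$. A stretch of a play $\pi$ is a finite subsequence $\pi_s\pi_{s+1}\cdots\pi_{s+l}$ of consecutive vertices; it is $k$-dominated if the minimal priority on it is $k$;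 its degree is the number of its vertices with priority $k$. The value $\theta_\Diamond(\pi)\in\mathbb{M}^\Diamond_{ext}$ of a play $\pi$ is $\top$ if $\pi$ is won by $\square$; if $\pi$ is won by $\Diamond$ it is the tuple $m\neq\top$ whose entry at each odd position $i$ is the degree of the maximal $i$-dominated stretch that is a prefix of $\pi$ (and $0$ at even positions). *)

theory Defs
  imports Main
begin

section \<open>Parity games, plays and strategies\<close>

datatype player = Diamond | Box

record 'v parity_game =
  verts :: "'v set"
  edges :: "('v \<times> 'v) set"
  prio :: "'v \<Rightarrow> nat"
  owned :: "player \<Rightarrow> 'v set"

definition parity_game :: "'v parity_game \<Rightarrow> bool" where
  "parity_game G \<longleftrightarrow>
     finite (verts G) \<and>
     owned G Diamond \<union> owned G Box = verts G \<and>
     owned G Diamond \<inter> owned G Box = {} \<and>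
     edges G \<subseteq> verts G \<times> verts G \<and>
     (\<forall>v\<in>verts G. \<exists>w. (v, w) \<in> edges G)"

definition succs :: "'v parity_game \<Rightarrow> 'v \<Rightarrow> 'v set" where
  "succs G v = {w. (v, w) \<in> edges G}"

definition verts_of_prio :: "'v parity_game \<Rightarrow> nat \<Rightarrow> 'v set" where
  "verts_of_prio G i = {v \<in> verts G. prio G v = i}"

definition play :: "'v parity_game \<Rightarrow> (nat \<Rightarrow> 'v) \<Rightarrow> bool" where
  "play G \<pi> \<longleftrightarrow> (\<forall>n. \<pi> n \<in> verts G \<and> \<pi> (Suc n) \<in> succs G (\<pi> n))"

definition won_by_Diamond :: "'v parity_game \<Rightarrow> (nat \<Rightarrow> 'v) \<Rightarrow> bool" where
  "won_by_Diamond G \<pi> \<longleftrightarrow> even (LEAST p. \<exists>\<^sub>\<infinity>n. prio G (\<pi> n) = p)"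

definition won_by_Box :: "'v parity_game \<Rightarrow> (nat \<Rightarrow> 'v) \<Rightarrow> bool" where
  "won_by_Box G \<pi> \<longleftrightarrow> \<not> won_by_Diamond G \<pi>"

definition finite_path :: "'v parity_game \<Rightarrow> 'v list \<Rightarrow> bool" where
  "finite_path G xs \<longleftrightarrow>
     xs \<noteq> [] \<and> set xs \<subseteq> verts G \<and> successively (\<lambda>x y. y \<in> succs G x) xs"

definition strategy :: "'v parity_game \<Rightarrow> player \<Rightarrow> ('v list \<Rightarrow> 'v option) \<Rightarrow> bool" where
  "strategy G p \<sigma> \<longleftrightarrow>
     dom \<sigma> = {xs. finite_path G xs \<and> last xs \<in> owned G p} \<and>
     (\<forall>xs w. \<sigma> xs = Some w \<longrightarrow> w \<in> succs G (last xs))"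

definition positional :: "('v list \<Rightarrow> 'v option) \<Rightarrow> bool" where
  "positional \<sigma> \<longleftrightarrow> (\<forall>xs\<in>dom \<sigma>. \<forall>ys\<in>dom \<sigma>. last xs = last ys \<longrightarrow> \<sigma> xs = \<sigma> ys)"

definition stretch :: "(nat \<Rightarrow> 'v) \<Rightarrow> nat \<Rightarrow> nat \<Rightarrow> 'v list" where
  "stretch \<pi> s l = map \<pi> [s..<Suc (s + l)]"

definition consistent :: "('v list \<Rightarrow> 'v option) \<Rightarrow> (nat \<Rightarrow> 'v) \<Rightarrow> bool" where
  "consistent \<sigma> \<pi> \<longleftrightarrow> (\<forall>n w. \<sigma> (stretch \<pi> 0 n) = Some w \<longrightarrow> \<pi> (Suc n) = w)"


section \<open>Measures\<close>

datatype pmeasure = Tuple "nat list" | Top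

text \<open>The library relation \<^const>\<open>lex\<close> relates only lists of equal length; tuples over
  the same game all have length \<open>dim G\<close>.\<close>

instantiation pmeasure :: order
begin

fun less_pmeasure :: "pmeasure \<Rightarrow> pmeasure \<Rightarrow> bool" where
  "less_pmeasure (Tuple \<alpha>) (Tuple \<beta>) \<longleftrightarrow> (\<alpha>, \<beta>) \<in> lex less_than"
| "less_pmeasure (Tuple \<alpha>) Top \<longleftrightarrow> True"
| "less_pmeasure Top m \<longleftrightarrow> False"

definition less_eq_pmeasure :: "pmeasure \<Rightarrow> pmeasure \<Rightarrow> bool" where
  "less_eq_pmeasure m n \<longleftrightarrow> m < n \<or> m = n"

instance
proof -
  have irr: "\<not> m < m" for m :: pmeasure
    by (cases m) (auto simp: wf_lex)
  have tr: "m < k" if "m < n" "n < k" for m n k :: pmeasure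
    using that
    by (cases m; cases n; cases k)
       (auto intro: lex_transI[THEN transD, OF trans_less_than])
  show "OFCLASS(pmeasure, order_class)"
    by standard (auto simp: less_eq_pmeasure_def irr dest: tr irr[THEN notE, OF tr])
qed

end

fun less_upto :: "nat \<Rightarrow> pmeasure \<Rightarrow> pmeasure \<Rightarrow> bool" where
  "less_upto i (Tuple \<alpha>) (Tuple \<beta>) \<longleftrightarrow> Tuple (take (Suc i) \<alpha>) < Tuple (take (Suc i) \<beta>)"
| "less_upto i (Tuple \<alpha>) Top \<longleftrightarrow> True"
| "less_upto i Top m \<longleftrightarrow> False"

fun eq_upto :: "nat \<Rightarrow> pmeasure \<Rightarrow> pmeasure \<Rightarrow> bool" where
  "eq_upto i (Tuple \<alpha>) (Tuple \<beta>) \<longleftrightarrow> take (Suc i) \<alpha> = take (Suc i) \<beta>"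
| "eq_upto i Top Top \<longleftrightarrow> True"
| "eq_upto i _ _ \<longleftrightarrow> False"

definition le_upto :: "nat \<Rightarrow> pmeasure \<Rightarrow> pmeasure \<Rightarrow> bool" where
  "le_upto i m n \<longleftrightarrow> less_upto i m n \<or> eq_upto i m n"

definition dim :: "'v parity_game \<Rightarrow> nat" where
  "dim G = Suc (Max (prio G ` verts G))"

definition ext_pmeasures :: "'v parity_game \<Rightarrow> pmeasure set" where
  "ext_pmeasures G =
     insert Top {Tuple \<alpha> | \<alpha>. length \<alpha> = dim G \<and> (\<forall>i<dim G. even i \<longrightarrow> \<alpha> ! i = 0)}"

definition pmeasures :: "'v parity_game \<Rightarrow> pmeasure set" where
  "pmeasures G =
     insert Top {Tuple \<alpha> | \<alpha>. length \<alpha> = dim G \<and>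
       (\<forall>i<dim G. (even i \<longrightarrow> \<alpha> ! i = 0) \<and> (odd i \<longrightarrow> \<alpha> ! i \<le> card (verts_of_prio G i)))}"


section \<open>Game parity progress measures\<close>

definition Prog :: "'v parity_game \<Rightarrow> ('v \<Rightarrow> pmeasure) \<Rightarrow> 'v \<Rightarrow> 'v \<Rightarrow> pmeasure" where
  "Prog G \<rho> v w = (LEAST m. m \<in> pmeasures G \<and>
     (if even (prio G v) then le_upto (prio G v) (\<rho> w) m
      else less_upto (prio G v) (\<rho> w) m \<or> (m = Top \<and> \<rho> w = Top)))"

definition game_progress_measure :: "'v parity_game \<Rightarrow> ('v \<Rightarrow> pmeasure) \<Rightarrow> bool" where
  "game_progress_measure G \<rho> \<longleftrightarrow>
     (\<forall>v\<in>verts G. \<rho> v \<in> pmeasures G) \<and>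
     (\<forall>v\<in>owned G Diamond. \<exists>w\<in>succs G v. le_upto (prio G v) (Prog G \<rho> v w) (\<rho> v)) \<and>
     (\<forall>v\<in>owned G Box. \<forall>w\<in>succs G v. le_upto (prio G v) (Prog G \<rho> v w) (\<rho> v))"

definition least_game_progress_measure ::
    "'v parity_game \<Rightarrow> ('v \<Rightarrow> pmeasure) \<Rightarrow> bool" where
  "least_game_progress_measure G \<rho> \<longleftrightarrow>
     game_progress_measure G \<rho> \<and>
     (\<forall>\<rho>'. game_progress_measure G \<rho>' \<longrightarrow> (\<forall>v\<in>verts G. \<rho> v \<le> \<rho>' v))"


section \<open>The value of a play\<close>

definition dominated :: "'v parity_game \<Rightarrow> nat \<Rightarrow> 'v list \<Rightarrow> bool" where
  "dominated G k xs \<longleftrightarrow> Min (prio G ` set xs) = k"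

definition degree :: "'v parity_game \<Rightarrow> nat \<Rightarrow> 'v list \<Rightarrow> nat" where
  "degree G k xs = length (filter (\<lambda>v. prio G v = k) xs)"

text \<open>Prefixes are nested and the degree grows with the prefix, so the supremum is the degree
  of the maximal \<open>i\<close>-dominated prefix. It is \<open>0\<close> if no prefix is \<open>i\<close>-dominated. If
  arbitrarily long prefixes are \<open>i\<close>-dominated, there is no longest one; the supremum then
  counts all (for odd \<open>i\<close> and a play won by Diamond: finitely many) visits to
  priority \<open>i\<close>. For example, \<open>1, 2, 2, 2, ...\<close> has degree \<open>1\<close> at position \<open>1\<close>.\<close>

definition prefix_degree :: "'v parity_game \<Rightarrow> nat \<Rightarrow> (nat \<Rightarrow> 'v) \<Rightarrow> nat" where
  "prefix_degree G i \<pi> = Sup {degree G i (stretch \<pi> 0 l) | l. dominated G i (stretch \<pi> 0 l)}"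

definition value_Diamond :: "'v parity_game \<Rightarrow> (nat \<Rightarrow> 'v) \<Rightarrow> pmeasure" where
  "value_Diamond G \<pi> =
     (if won_by_Box G \<pi> then Top
      else Tuple (map (\<lambda>i. if odd i then prefix_degree G i \<pi> else 0) [0..<dim G]))"

lemma value_Diamond_in_ext_pmeasures: "value_Diamond G \<pi> \<in> ext_pmeasures G"
  by (auto simp: value_Diamond_def ext_pmeasures_def)

end

theory Submission
  imports Defs "HOL-Library.Infinite_Set"
begin

text \<open>The value of a play is determined by the value of its tail: it is the least measure that
  progresses from it in the sense of a progress measure with unbounded entries. For Diamond,
  following the choices made by a progress measure therefore keeps the value below the measure,
  by backward induction from a position whose value is the zero tuple.

  For Box, let \<open>\<mu> v\<close> be the largest bounded measure that Box can force from \<open>v\<close>. If \<open>\<mu>\<close> is a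
  progress measure then \<open>\<rho> \<le> \<mu>\<close> by leastness. The one obstacle is the bound \<open>card (V\<^sub>i)\<close> on
  entry \<open>i\<close>: we need that a Box player who can force more than \<open>card (V\<^sub>i)\<close> visits to priority
  \<open>i\<close> can force a larger value already on the entries below \<open>i\<close>. By the pigeonhole principle,
  for some \<open>n\<close> the vertices of priority \<open>i\<close> from which Box can force \<open>n\<close> visits are those from
  which \<open>n + 1\<close> visits can be forced, and then Box can pump: restarting the strategy for
  \<open>n + 1\<close> visits at each visit, Box either visits \<open>i\<close> forever and wins, or the play ends up
  with fewer visits than promised and must make up for it below \<open>i\<close>.\<close>

section \<open>Lexicographic comparison of tuples\<close>

text \<open>Tuples are handled as functions on \<open>nat\<close>, so that truncation to positions
  \<open>0..i\<close> is the choice \<open>d = Suc i\<close>. With \<open>d = 0\<close> nothing is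
  strictly smaller and everything agrees, which later starts an induction over positions.\<close>

definition lexlt :: "nat \<Rightarrow> (nat \<Rightarrow> nat) \<Rightarrow> (nat \<Rightarrow> nat) \<Rightarrow> bool" where
  "lexlt d a b \<longleftrightarrow> (\<exists>j<d. a j < b j \<and> (\<forall>k<j. a k = b k))"

definition agree :: "nat \<Rightarrow> (nat \<Rightarrow> nat) \<Rightarrow> (nat \<Rightarrow> nat) \<Rightarrow> bool" where
  "agree d a b \<longleftrightarrow> (\<forall>k<d. a k = b k)"

lemma lexlt_trans: "lexlt d a b \<Longrightarrow> lexlt d b c \<Longrightarrow> lexlt d a c"
proof -
  assume "lexlt d a b" "lexlt d b c"
  then obtain i j where i: "i < d" "a i < b i" "\<forall>k<i. a k = b k"
    and j: "j < d" "b j < c j" "\<forall>k<j. b k = c k"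
    unfolding lexlt_def by blast
  have "a (min i j) < c (min i j)"
    using i j by (cases i j rule: linorder_cases) (auto simp: min_def)
  then show ?thesis
    unfolding lexlt_def using i j by (intro exI[of _ "min i j"]) auto
qed

lemma lexlt_agree: "lexlt d a b \<Longrightarrow> agree d b c \<Longrightarrow> lexlt d a c"
  unfolding lexlt_def agree_def by (metis order_less_trans)

lemma agree_lexlt: "agree d a b \<Longrightarrow> lexlt d b c \<Longrightarrow> lexlt d a c"
  unfolding lexlt_def agree_def by (metis order_less_trans)

lemma agree_trans: "agree d a b \<Longrightarrow> agree d b c \<Longrightarrow> agree d a c"
  by (simp add: agree_def)

lemma agree_sym: "agree d a b \<Longrightarrow> agree d b a"
  by (simp add: agree_def)

lemma agree_mono: "agree d a b \<Longrightarrow> e \<le> d \<Longrightarrow> agree e a b"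
  by (simp add: agree_def)

lemma lexlt_linear: "lexlt d a b \<or> agree d a b \<or> lexlt d b a"
proof (cases "agree d a b")
  case False
  define j where "j = (LEAST j. j < d \<and> a j \<noteq> b j)"
  have "\<exists>j. j < d \<and> a j \<noteq> b j" using False by (auto simp: agree_def)
  then have j: "j < d" "a j \<noteq> b j"
    using LeastI_ex[of "\<lambda>j. j < d \<and> a j \<noteq> b j"] by (auto simp: j_def)
  moreover have "\<forall>k<j. a k = b k"
    using j(1) not_less_Least[of _ "\<lambda>j. j < d \<and> a j \<noteq> b j"]
    unfolding j_def by (metis (lifting) order_less_trans)
  ultimately show ?thesis
    unfolding lexlt_def by (metis linorder_neqE_nat)
qed simp

lemma lexlt_truncate: "lexlt d a b \<Longrightarrow> e \<le> d \<Longrightarrow> lexlt e a b \<or> agree e a b"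
  unfolding lexlt_def agree_def by (meson leI order_less_le_trans)

lemma lexlt_extend: "lexlt e a b \<Longrightarrow> e \<le> d \<Longrightarrow> lexlt d a b"
  unfolding lexlt_def by (meson order_less_le_trans)

lemma lexlt_irrefl: "lexlt d a b \<Longrightarrow> agree d a b \<Longrightarrow> False"
  by (auto simp: lexlt_def agree_def)

lemma lexlt_Suc: "lexlt (Suc j) a b \<longleftrightarrow> lexlt j a b \<or> agree j a b \<and> a j < b j"
  unfolding lexlt_def agree_def by (auto simp: less_Suc_eq)

text \<open>A tuple that vanishes from \<open>e\<close> on cannot be the larger one at a first
  difference there, so comparing \<open>e\<close> entries already decides the weak
  comparison.\<close>

lemma lexle_extend_zero:
  assumes "lexlt e b a \<or> agree e b a" "e \<le> d" "\<And>k. e \<le> k \<Longrightarrow> b k = 0"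
  shows "lexlt d b a \<or> agree d b a"
proof (cases "lexlt e b a")
  case True
  then show ?thesis using lexlt_extend assms(2) by blast
next
  case False
  then have ag: "agree e b a" using assms(1) by simp
  have "\<not> lexlt d a b"
  proof
    assume "lexlt d a b"
    then obtain j where "a j < b j" by (auto simp: lexlt_def)
    with ag assms(3)[of j] show False by (cases "j < e") (auto simp: agree_def)
  qed
  then show ?thesis using lexlt_linear by blast
qed

lemma lex_less_than_iff:
  assumes "length xs = length ys"
  shows "(xs, ys) \<in> lex less_than \<longleftrightarrow> lexlt (length xs) (nth xs) (nth ys)"
proof
  assume "(xs, ys) \<in> lex less_than"
  then obtain i where i: "i < length xs" "i < length ys" "take i xs = take i ys" "xs ! i < ys ! i"
    by (auto elim: lex_take_index)
  then show "lexlt (length xs) (nth xs) (nth ys)"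
    unfolding lexlt_def by (metis nth_take)
next
  assume "lexlt (length xs) (nth xs) (nth ys)"
  then obtain j where j: "j < length xs" "xs ! j < ys ! j" "\<forall>k<j. xs ! k = ys ! k"
    by (auto simp: lexlt_def)
  have "take j xs = take j ys"
    using j assms by (intro nth_take_lemma) auto
  moreover have "xs = take j xs @ xs ! j # drop (Suc j) xs" "ys = take j ys @ ys ! j # drop (Suc j) ys"
    using j(1) assms by (auto simp: id_take_nth_drop)
  ultimately show "(xs, ys) \<in> lex less_than"
    using j(1,2) assms unfolding lex_conv by (auto intro!: exI)
qed

text \<open>The condition whose least solution \<open>m\<close> is \<open>Prog\<close>, with
  \<open>x\<close> the measure of the successor. As a relation it also makes sense for unbounded
  measures such as values of plays.\<close>

definition progresses :: "nat \<Rightarrow> pmeasure \<Rightarrow> pmeasure \<Rightarrow> bool" where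
  "progresses p x m \<longleftrightarrow>
     (if even p then le_upto p x m else less_upto p x m \<or> (m = Top \<and> x = Top))"

section \<open>The tuples of a game\<close>

locale game =
  fixes G :: "'v parity_game"
  assumes parity_game: "parity_game G"
begin

lemma finite_verts: "finite (verts G)"
  and owned_verts: "owned G Diamond \<union> owned G Box = verts G"
  and succs_verts: "w \<in> succs G v \<Longrightarrow> w \<in> verts G"
  and succs_nonempty: "v \<in> verts G \<Longrightarrow> \<exists>w. w \<in> succs G v"
  using parity_game unfolding parity_game_def succs_def by auto

definition tuple :: "(nat \<Rightarrow> nat) \<Rightarrow> pmeasure" where
  "tuple a = Tuple (map a [0..<dim G])"

lemma prio_less_dim: "v \<in> verts G \<Longrightarrow> prio G v < dim G"
  unfolding dim_def using finite_verts by (simp add: less_Suc_eq_le)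

lemma tuple_eq_iff: "tuple a = tuple b \<longleftrightarrow> agree (dim G) a b"
  by (auto simp: tuple_def agree_def)

lemma lexlt_cong: "(\<And>k. k < d \<Longrightarrow> a k = a' k) \<Longrightarrow> (\<And>k. k < d \<Longrightarrow> b k = b' k) \<Longrightarrow> lexlt d a b = lexlt d a' b'"
  unfolding lexlt_def by (intro ex_cong1) auto

lemma tuple_less_iff: "tuple a < tuple b \<longleftrightarrow> lexlt (dim G) a b"
  unfolding tuple_def less_pmeasure.simps
  by (subst lex_less_than_iff) (auto intro!: lexlt_cong)

lemma less_upto_tuple_iff:
  assumes "i < dim G"
  shows "less_upto i (tuple a) (tuple b) \<longleftrightarrow> lexlt (Suc i) a b"
  using assms unfolding tuple_def less_upto.simps less_pmeasure.simps
  by (subst lex_less_than_iff) (auto intro!: lexlt_cong simp: min_absorb2 Suc_leI)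

lemma eq_upto_tuple_iff:
  assumes "i < dim G"
  shows "eq_upto i (tuple a) (tuple b) \<longleftrightarrow> agree (Suc i) a b"
  using assms unfolding tuple_def agree_def by (auto simp: list_eq_iff_nth_eq)

lemma tuple_neq_Top [simp]: "tuple a \<noteq> Top" "Top \<noteq> tuple a"
  by (auto simp: tuple_def)

lemma tuple_less_Top [simp]: "tuple a < Top" "\<not> Top < tuple a"
  by (auto simp: tuple_def)

lemma tuple_upto_Top [simp]:
  "less_upto i (tuple a) Top" "\<not> less_upto i Top m" "\<not> eq_upto i Top (tuple a)" "\<not> eq_upto i (tuple a) Top"
  by (auto simp: tuple_def)

lemma le_Top [simp]: "m \<le> (Top :: pmeasure)"
  by (cases m) (auto simp: less_eq_pmeasure_def)

lemma tuple_le_iff: "tuple a \<le> tuple b \<longleftrightarrow> lexlt (dim G) a b \<or> agree (dim G) a b"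
  by (simp add: less_eq_pmeasure_def tuple_less_iff tuple_eq_iff)

lemma ext_pmeasures_cases:
  assumes "m \<in> ext_pmeasures G"
  obtains "m = Top" | a where "m = tuple a" "\<And>k. even k \<Longrightarrow> a k = 0"
proof (cases m)
  case (Tuple \<alpha>)
  with assms have \<alpha>: "length \<alpha> = dim G" "\<And>i. i < dim G \<Longrightarrow> even i \<Longrightarrow> \<alpha> ! i = 0"
    by (auto simp: ext_pmeasures_def)
  \<comment> \<open>Padding with zeros makes the representative vanish at every even position, not
    only at those below \<open>dim G\<close>.\<close>
  then have "m = tuple (\<lambda>k. if k < dim G then \<alpha> ! k else 0)"
    by (auto simp: Tuple tuple_def intro: nth_equalityI)
  with that(2) \<alpha> show ?thesis by auto
qed (use that in auto)

lemma pmeasures_subset: "pmeasures G \<subseteq> ext_pmeasures G"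
  by (auto simp: pmeasures_def ext_pmeasures_def)

lemma Top_pmeasures: "Top \<in> pmeasures G"
  by (simp add: pmeasures_def)

lemma tuple_ext_pmeasures: "(\<And>k. even k \<Longrightarrow> a k = 0) \<Longrightarrow> tuple a \<in> ext_pmeasures G"
  by (auto simp: ext_pmeasures_def tuple_def)

lemma tuple_pmeasures_iff:
  "tuple a \<in> pmeasures G \<longleftrightarrow>
     (\<forall>i<dim G. (even i \<longrightarrow> a i = 0) \<and> (odd i \<longrightarrow> a i \<le> card (verts_of_prio G i)))"
  by (auto simp: pmeasures_def tuple_def)

lemma ext_pmeasures_linear:
  assumes "x \<in> ext_pmeasures G" "y \<in> ext_pmeasures G"
  shows "x \<le> y \<or> y < x"
  using assms lexlt_linear[of "dim G"]
  by (elim ext_pmeasures_cases) (auto simp: tuple_le_iff tuple_less_iff dest: agree_sym)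

lemma zero_le: "m \<in> ext_pmeasures G \<Longrightarrow> tuple (\<lambda>_. 0) \<le> m"
  using ext_pmeasures_linear[of "tuple (\<lambda>_. 0)" m] tuple_ext_pmeasures
  by (auto simp: tuple_less_iff lexlt_def elim: ext_pmeasures_cases)

lemma finite_pmeasures: "finite (pmeasures G)"
proof -
  have card: "card (verts_of_prio G i) \<le> card (verts G)" for i
    using finite_verts by (intro card_mono) (auto simp: verts_of_prio_def)
  have "xs ! i \<le> card (verts G)" if "Tuple xs \<in> pmeasures G" "i < length xs" for xs i
    using that card[of i] by (cases "even i") (auto simp: pmeasures_def intro: le_trans)
  then have "set xs \<subseteq> {..card (verts G)} \<and> length xs = dim G" if "Tuple xs \<in> pmeasures G" for xs
    using that by (auto simp: in_set_conv_nth) (simp add: pmeasures_def)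
  then have "m \<in> insert Top (Tuple ` {xs. set xs \<subseteq> {..card (verts G)} \<and> length xs = dim G})"
    if "m \<in> pmeasures G" for m
    using that by (cases m) auto
  then have "pmeasures G \<subseteq>
      insert Top (Tuple ` {xs. set xs \<subseteq> {..card (verts G)} \<and> length xs = dim G})"
    by blast
  then show ?thesis
    by (rule finite_subset) (simp add: finite_lists_length_eq)
qed

section \<open>Transitivity and monotonicity of truncated comparisons\<close>

lemma le_upto_trans:
  assumes "i < dim G" "x \<in> ext_pmeasures G" "y \<in> ext_pmeasures G" "z \<in> ext_pmeasures G"
    "le_upto i x y" "le_upto i y z"
  shows "le_upto i x z"
  using assms
  by (elim ext_pmeasures_cases)
     (auto simp: le_upto_def less_upto_tuple_iff eq_upto_tuple_iff
       intro: lexlt_trans lexlt_agree agree_lexlt agree_trans)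

lemma less_le_upto_trans:
  assumes "i < dim G" "x \<in> ext_pmeasures G" "y \<in> ext_pmeasures G" "z \<in> ext_pmeasures G"
    "less_upto i x y" "le_upto i y z"
  shows "less_upto i x z"
  using assms
  by (elim ext_pmeasures_cases)
     (auto simp: le_upto_def less_upto_tuple_iff eq_upto_tuple_iff
       intro: lexlt_trans lexlt_agree)

lemma le_less_upto_trans:
  assumes "i < dim G" "x \<in> ext_pmeasures G" "y \<in> ext_pmeasures G" "z \<in> ext_pmeasures G"
    "le_upto i x y" "less_upto i y z"
  shows "less_upto i x z"
  using assms
  by (elim ext_pmeasures_cases)
     (auto simp: le_upto_def less_upto_tuple_iff eq_upto_tuple_iff
       intro: lexlt_trans agree_lexlt)

lemma le_imp_le_upto:
  assumes "i < dim G" "x \<in> ext_pmeasures G" "y \<in> ext_pmeasures G" "x \<le> y"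
  shows "le_upto i x y"
  using assms
proof (cases "x = y")
  case False
  then have "x < y" using assms(4) by simp
  with assms show ?thesis
    using lexlt_truncate[of "dim G" _ _ "Suc i"]
    by (elim ext_pmeasures_cases)
       (auto simp: le_upto_def less_upto_tuple_iff eq_upto_tuple_iff tuple_less_iff Suc_le_eq)
next
  case True
  with assms(2) show ?thesis
    by (cases y) (auto simp: le_upto_def)
qed

lemma le_upto_Top_left: "x \<in> ext_pmeasures G \<Longrightarrow> le_upto i Top x \<Longrightarrow> x = Top"
  by (elim ext_pmeasures_cases) (auto simp: le_upto_def)

lemma progresses_Top: "x \<in> ext_pmeasures G \<Longrightarrow> progresses p x Top"
  by (elim ext_pmeasures_cases) (auto simp: progresses_def le_upto_def)

lemma progresses_le_upto:
  assumes "i < dim G" "x \<in> ext_pmeasures G" "y \<in> ext_pmeasures G" "z \<in> ext_pmeasures G"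
    "progresses i x y" "le_upto i y z"
  shows "progresses i x z"
  using assms le_upto_Top_left le_upto_trans less_le_upto_trans unfolding progresses_def
  by metis

lemma le_progresses:
  assumes "i < dim G" "x \<in> ext_pmeasures G" "y \<in> ext_pmeasures G" "z \<in> ext_pmeasures G"
    "x \<le> y" "progresses i y z"
  shows "progresses i x z"
proof (cases "z = Top")
  case False
  then show ?thesis
    using assms le_imp_le_upto le_upto_trans le_less_upto_trans unfolding progresses_def
    by metis
qed (use assms progresses_Top in auto)

section \<open>Existence of \<open>Prog\<close> and its elimination\<close>

lemma Prog_least:
  assumes "\<rho> w \<in> pmeasures G"
  shows "Prog G \<rho> v w \<in> pmeasures G" "progresses (prio G v) (\<rho> w) (Prog G \<rho> v w)"
    "\<And>m. m \<in> pmeasures G \<Longrightarrow> progresses (prio G v) (\<rho> w) m \<Longrightarrow> Prog G \<rho> v w \<le> m"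
proof -
  define S where "S = {m \<in> pmeasures G. progresses (prio G v) (\<rho> w) m}"
  have Prog: "Prog G \<rho> v w = (LEAST m. m \<in> S)"
    by (simp add: Prog_def S_def progresses_def)
  have "finite S" "S \<noteq> {}"
    using finite_pmeasures Top_pmeasures progresses_Top assms pmeasures_subset
    by (auto simp: S_def)
  \<comment> \<open>Finiteness gives only a minimal element; linearity of the order on measures
    makes it least.\<close>
  then obtain m where m: "m \<in> S" "\<And>y. y \<in> S \<Longrightarrow> y \<le> m \<Longrightarrow> m = y"
    using finite_has_minimal by metis
  have least: "m \<le> y" if "y \<in> S" for y
    using m that ext_pmeasures_linear[of m y] pmeasures_subset by (force simp: S_def)
  have "Prog G \<rho> v w = m"
    unfolding Prog using m(1) least by (intro Least_equality)
  with m(1) least show "Prog G \<rho> v w \<in> pmeasures G" "progresses (prio G v) (\<rho> w) (Prog G \<rho> v w)"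
    "\<And>m. m \<in> pmeasures G \<Longrightarrow> progresses (prio G v) (\<rho> w) m \<Longrightarrow> Prog G \<rho> v w \<le> m"
    by (auto simp: S_def)
qed

text \<open>Left to right, the defining property of \<open>Prog\<close> is carried up to
  \<open>m\<close>; right to left, leastness gives \<open>Prog G \<rho> v w \<le> m\<close>, hence
  the truncated comparison. Progress measures can then be treated through \<open>progresses\<close>
  alone.\<close>

lemma Prog_le_upto_iff:
  assumes "v \<in> verts G" "\<rho> w \<in> pmeasures G" "m \<in> pmeasures G"
  shows "le_upto (prio G v) (Prog G \<rho> v w) m \<longleftrightarrow> progresses (prio G v) (\<rho> w) m"
  using assms Prog_least[where \<rho> = \<rho> and w = w and v = v, OF assms(2)] prio_less_dim[of v] pmeasures_subset
    progresses_le_upto[of "prio G v" "\<rho> w" "Prog G \<rho> v w" m]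
    le_imp_le_upto[of "prio G v" "Prog G \<rho> v w" m] by blast

lemma game_progress_measure_iff:
  "game_progress_measure G \<rho> \<longleftrightarrow>
     (\<forall>v\<in>verts G. \<rho> v \<in> pmeasures G) \<and>
     (\<forall>v\<in>owned G Diamond. \<exists>w\<in>succs G v. progresses (prio G v) (\<rho> w) (\<rho> v)) \<and>
     (\<forall>v\<in>owned G Box. \<forall>w\<in>succs G v. progresses (prio G v) (\<rho> w) (\<rho> v))"
proof (cases "\<forall>v\<in>verts G. \<rho> v \<in> pmeasures G")
  case True
  then have "le_upto (prio G v) (Prog G \<rho> v w) (\<rho> v) \<longleftrightarrow> progresses (prio G v) (\<rho> w) (\<rho> v)"
    if "v \<in> owned G p" "w \<in> succs G v" for p v w
    using True that owned_verts succs_verts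
    by (intro Prog_le_upto_iff) (cases p; auto)+
  with True show ?thesis
    unfolding game_progress_measure_def by simp
qed (auto simp: game_progress_measure_def)

section \<open>The value of a play, one step at a time\<close>

definition tail :: "nat \<Rightarrow> (nat \<Rightarrow> 'v) \<Rightarrow> nat \<Rightarrow> 'v" where
  "tail k \<pi> = (\<lambda>n. \<pi> (n + k))"

text \<open>These are the occurrences of \<open>i\<close> before any smaller priority. The set makes
  sense also when there is no longest \<open>i\<close>-dominated prefix.\<close>

definition visits :: "nat \<Rightarrow> (nat \<Rightarrow> 'v) \<Rightarrow> nat set" where
  "visits i \<pi> = {k. prio G (\<pi> k) = i \<and> (\<forall>j\<le>k. i \<le> prio G (\<pi> j))}"

text \<open>An infinite set has cardinality \<open>0\<close>, so \<open>count\<close> is read as an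
  entry of the value only when Diamond wins, where visits to odd priorities are finite.\<close>

definition count :: "(nat \<Rightarrow> 'v) \<Rightarrow> nat \<Rightarrow> nat" where
  "count \<pi> i = (if odd i then card (visits i \<pi>) else 0)"

lemma tail_tail: "tail k (tail l \<pi>) = tail (k + l) \<pi>"
  by (simp add: tail_def add.assoc)

lemma tail_apply: "tail k \<pi> n = \<pi> (n + k)"
  by (simp add: tail_def)

lemma play_tail: "play G \<pi> \<Longrightarrow> play G (tail k \<pi>)"
  by (simp add: play_def tail_def)

lemma play_verts: "play G \<pi> \<Longrightarrow> \<pi> n \<in> verts G"
  by (simp add: play_def)

text \<open>Priorities stay below \<open>dim G\<close>, so some priority recurs by pigeonhole;
  \<open>p\<close> is the least such, and the finitely many smaller ones occur finitely often
  altogether.\<close>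

lemma liminf_prio:
  assumes "play G \<pi>"
  obtains p where "\<exists>\<^sub>\<infinity>n. prio G (\<pi> n) = p" "\<forall>\<^sub>\<infinity>n. p \<le> prio G (\<pi> n)"
    "won_by_Diamond G \<pi> \<longleftrightarrow> even p"
proof -
  define p where "p = (LEAST p. \<exists>\<^sub>\<infinity>n. prio G (\<pi> n) = p)"
  have "range (\<lambda>n. prio G (\<pi> n)) \<subseteq> {..<dim G}"
    using assms play_verts prio_less_dim by auto
  then have "finite (range (\<lambda>n. prio G (\<pi> n)))"
    using finite_subset by blast
  then obtain q where "\<exists>\<^sub>\<infinity>n. prio G (\<pi> n) = q"
    using pigeonhole_infinite[of UNIV "\<lambda>n. prio G (\<pi> n)"]
    by (auto simp: INFM_iff_infinite)
  then have 1: "\<exists>\<^sub>\<infinity>n. prio G (\<pi> n) = p"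
    unfolding p_def by (rule LeastI)
  have "\<not> (\<exists>\<^sub>\<infinity>n. prio G (\<pi> n) = q)" if "q < p" for q
    using not_less_Least that unfolding p_def by blast
  then have "finite (\<Union>q<p. {n. prio G (\<pi> n) = q})"
    by (auto simp: INFM_iff_infinite)
  then have 2: "\<forall>\<^sub>\<infinity>n. p \<le> prio G (\<pi> n)"
    unfolding MOST_iff_finiteNeg by (rule finite_subset[rotated]) auto
  show thesis
    by (rule that[OF 1 2]) (simp add: won_by_Diamond_def p_def)
qed

lemma won_by_Diamond_tail: "won_by_Diamond G (tail k \<pi>) = won_by_Diamond G \<pi>"
proof -
  have "(\<exists>\<^sub>\<infinity>n. prio G (tail k \<pi> n) = p) = (\<exists>\<^sub>\<infinity>n. prio G (\<pi> n) = p)" for p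
    unfolding INFM_nat_le tail_def
    by (metis add.commute add_leD2 add_le_imp_le_diff le_add_diff_inverse2 trans_le_add1)
  then show ?thesis by (simp add: won_by_Diamond_def)
qed

lemma won_by_Box_tail: "won_by_Box G (tail k \<pi>) = won_by_Box G \<pi>"
  by (simp add: won_by_Box_def won_by_Diamond_tail)

text \<open>Every position is followed by a further visit, so no priority below \<open>i\<close>
  ever occurs, and \<open>i\<close> is the least recurring one.\<close>

lemma infinite_visits_won_by_Box:
  assumes "play G \<pi>" "odd i" "infinite (visits i \<pi>)"
  shows "won_by_Box G \<pi>"
proof -
  obtain p where p: "\<exists>\<^sub>\<infinity>n. prio G (\<pi> n) = p" "\<forall>\<^sub>\<infinity>n. p \<le> prio G (\<pi> n)"
    "won_by_Diamond G \<pi> \<longleftrightarrow> even p"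
    using liminf_prio assms(1) by metis
  have inf: "\<exists>\<^sub>\<infinity>n. n \<in> visits i \<pi>"
    using assms(3) by (simp add: INFM_iff_infinite)
  have "\<exists>\<^sub>\<infinity>n. n \<in> visits i \<pi> \<and> p \<le> prio G (\<pi> n)"
    by (rule INFM_conjI[OF inf p(2)])
  then have "p \<le> i"
    by (auto simp: visits_def dest: INFM_EX)
  moreover obtain n where n: "prio G (\<pi> n) = p"
    using p(1) INFM_EX by blast
  obtain m where "m > n" "m \<in> visits i \<pi>"
    using inf by (auto simp: INFM_nat)
  with n have "i \<le> p" by (auto simp: visits_def)
  ultimately have "p = i" by simp
  with p(3) assms(2) show ?thesis by (simp add: won_by_Box_def)
qed

section \<open>Degrees of dominated prefixes as numbers of visits\<close>

lemma degree_stretch: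
  "degree G i (stretch \<pi> 0 l) = card {k. k \<le> l \<and> prio G (\<pi> k) = i}"
proof -
  have "degree G i (stretch \<pi> 0 l) = card {k. k < Suc l \<and> prio G (map \<pi> [0..<Suc l] ! k) = i}"
    unfolding degree_def stretch_def by (simp add: length_filter_conv_card del: upt_Suc)
  also have "{k. k < Suc l \<and> prio G (map \<pi> [0..<Suc l] ! k) = i} = {k. k \<le> l \<and> prio G (\<pi> k) = i}"
    by (auto simp del: upt_Suc)
  finally show ?thesis .
qed

lemma dominated_stretch:
  "dominated G i (stretch \<pi> 0 l) \<longleftrightarrow>
     (\<exists>k\<le>l. prio G (\<pi> k) = i) \<and> (\<forall>k\<le>l. i \<le> prio G (\<pi> k))"
proof -
  have "prio G ` set (stretch \<pi> 0 l) = (\<lambda>k. prio G (\<pi> k)) ` {..l}"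
    by (auto simp: stretch_def simp del: upt_Suc)
  then show ?thesis
    unfolding dominated_def by (auto simp: Min_eq_iff)
qed

lemma prefix_degree_eq_card_visits:
  assumes "finite (visits i \<pi>)"
  shows "prefix_degree G i \<pi> = card (visits i \<pi>)"
proof (cases "visits i \<pi> = {}")
  case True
  have "\<not> dominated G i (stretch \<pi> 0 l)" for l
    using True by (auto simp: dominated_stretch visits_def)
  then show ?thesis
    by (simp add: prefix_degree_def True)
next
  case False
  let ?D = "{degree G i (stretch \<pi> 0 l) | l. dominated G i (stretch \<pi> 0 l)}"
  \<comment> \<open>The prefix ending at the last visit attains the supremum, since any
    \<open>i\<close>-dominated prefix counts a subset of the visits.\<close>
  define l where "l = Max (visits i \<pi>)"
  have l: "l \<in> visits i \<pi>" "\<And>k. k \<in> visits i \<pi> \<Longrightarrow> k \<le> l"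
    using assms False by (auto simp: l_def)
  have "dominated G i (stretch \<pi> 0 l)"
    using l(1) by (auto simp: dominated_stretch visits_def)
  moreover have "{k. k \<le> l \<and> prio G (\<pi> k) = i} = visits i \<pi>"
    using l by (fastforce simp: visits_def)
  ultimately have "card (visits i \<pi>) \<in> ?D"
    by (auto simp: degree_stretch intro!: exI[of _ l])
  moreover have "x \<le> card (visits i \<pi>)" if "x \<in> ?D" for x
    using that assms
    by (auto simp: degree_stretch dominated_stretch visits_def intro!: card_mono)
  ultimately show ?thesis
    unfolding prefix_degree_def by (rule cSup_eq_maximum)
qed

lemma value_Diamond_eq:
  assumes "play G \<pi>"
  shows "value_Diamond G \<pi> = (if won_by_Box G \<pi> then Top else tuple (count \<pi>))"
  using assms infinite_visits_won_by_Box prefix_degree_eq_card_visits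
  by (auto simp: value_Diamond_def tuple_def count_def)

section \<open>Counts and values along the tails of a play\<close>

lemma visits_tail:
  assumes "\<And>n. n < k \<Longrightarrow> i < prio G (\<pi> n)"
  shows "visits i \<pi> = (\<lambda>n. n + k) ` visits i (tail k \<pi>)"
proof (intro equalityI subsetI)
  fix m assume m: "m \<in> visits i \<pi>"
  then have "k \<le> m" using assms[of m] by (intro leI) (auto simp: visits_def)
  with m show "m \<in> (\<lambda>n. n + k) ` visits i (tail k \<pi>)"
    by (intro image_eqI[of _ _ "m - k"]) (auto simp: visits_def tail_def)
next
  fix m assume "m \<in> (\<lambda>n. n + k) ` visits i (tail k \<pi>)"
  then obtain n where n: "m = n + k" "n \<in> visits i (tail k \<pi>)" by auto
  then have n': "prio G (\<pi> m) = i" "\<And>j. j \<le> n \<Longrightarrow> i \<le> prio G (\<pi> (j + k))"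
    by (auto simp: visits_def tail_def)
  have "i \<le> prio G (\<pi> j)" if "j \<le> m" for j
    using n'(2)[of "j - k"] assms[of j] that n(1) by (cases "j < k") auto
  with n' show "m \<in> visits i \<pi>" by (simp add: visits_def)
qed

lemma count_tail:
  assumes "\<And>n. n < k \<Longrightarrow> i < prio G (\<pi> n)"
  shows "count \<pi> i = count (tail k \<pi>) i"
proof -
  have "visits i \<pi> = (\<lambda>n. n + k) ` visits i (tail k \<pi>)"
    using assms by (rule visits_tail)
  then show ?thesis
    by (simp add: count_def card_image)
qed

lemma visits_Suc:
  assumes "prio G (\<pi> 0) = i"
  shows "visits i \<pi> = insert 0 (Suc ` visits i (tail 1 \<pi>))"
proof -
  have "(\<forall>j\<le>Suc n. i \<le> prio G (\<pi> j)) \<longleftrightarrow> (\<forall>j\<le>n. i \<le> prio G (\<pi> (Suc j)))" for n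
    using assms by (metis Suc_le_mono le_refl not0_implies_Suc)
  then have "m \<in> visits i \<pi> \<longleftrightarrow> m = 0 \<or> (\<exists>n. m = Suc n \<and> n \<in> visits i (tail 1 \<pi>))" for m
    using assms by (cases m) (auto simp: visits_def tail_def)
  then show ?thesis by auto
qed

lemma count_Suc:
  assumes "play G \<pi>" "won_by_Diamond G \<pi>" "prio G (\<pi> 0) = i" "odd i"
  shows "count \<pi> i = Suc (count (tail 1 \<pi>) i)"
proof -
  have "finite (visits i (tail 1 \<pi>))"
    using assms infinite_visits_won_by_Box[of "tail 1 \<pi>" i] play_tail
    by (auto simp: won_by_Box_def won_by_Diamond_tail)
  then show ?thesis
    using assms(3,4) by (simp add: count_def visits_Suc card_image)
qed

lemma count_above: "prio G (\<pi> 0) < i \<Longrightarrow> count \<pi> i = 0"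
proof -
  assume "prio G (\<pi> 0) < i"
  then have "visits i \<pi> = {}" by (force simp: visits_def)
  then show ?thesis by (simp add: count_def)
qed

text \<open>Entries below the first priority \<open>p\<close> are those of the tail. Entry
  \<open>p\<close> grows by one if \<open>p\<close> is odd and is \<open>0\<close> on both sides if
  \<open>p\<close> is even.\<close>

lemma value_tail_progresses:
  assumes "play G \<pi>"
  shows "progresses (prio G (\<pi> 0)) (value_Diamond G (tail 1 \<pi>)) (value_Diamond G \<pi>)"
proof (cases "won_by_Box G \<pi>")
  case True
  then show ?thesis
    using assms play_tail by (simp add: value_Diamond_eq won_by_Box_tail progresses_def le_upto_def)
next
  case False
  let ?p = "prio G (\<pi> 0)"
  have p: "?p < dim G" using assms play_verts prio_less_dim by auto
  have below: "agree ?p (count (tail 1 \<pi>)) (count \<pi>)"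
    unfolding agree_def by (metis count_tail less_one)
  have "lexlt (Suc ?p) (count (tail 1 \<pi>)) (count \<pi>)" if "odd ?p"
    using below count_Suc assms False that by (auto simp: lexlt_Suc won_by_Box_def)
  moreover have "agree (Suc ?p) (count (tail 1 \<pi>)) (count \<pi>)" if "even ?p"
    using below that by (auto simp: agree_def less_Suc_eq count_def)
  ultimately show ?thesis
    using assms play_tail False p
    by (auto simp: value_Diamond_eq won_by_Box_tail progresses_def le_upto_def
        less_upto_tuple_iff eq_upto_tuple_iff)
qed

text \<open>Leastness of the value: its entries up to the first priority are as small as progress
  from the tail permits, and the entries above it are \<open>0\<close>.\<close>

lemma value_le_of_progresses:
  assumes "play G \<pi>" "won_by_Diamond G \<pi>" "m \<in> ext_pmeasures G" "n \<in> ext_pmeasures G"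
    and "value_Diamond G (tail 1 \<pi>) \<le> n" "progresses (prio G (\<pi> 0)) n m"
  shows "value_Diamond G \<pi> \<le> m"
proof (cases "m = Top")
  case False
  then obtain a where a: "m = tuple a"
    using assms(3) ext_pmeasures_cases by metis
  let ?p = "prio G (\<pi> 0)" and ?b = "count (tail 1 \<pi>)"
  have p: "?p < dim G" using assms play_verts prio_less_dim by auto
  have "progresses ?p (value_Diamond G (tail 1 \<pi>)) m"
    using le_progresses p assms value_Diamond_in_ext_pmeasures by metis
  then have "if even ?p then lexlt (Suc ?p) ?b a \<or> agree (Suc ?p) ?b a else lexlt (Suc ?p) ?b a"
    using assms(1,2) play_tail p a
    by (auto simp: progresses_def le_upto_def value_Diamond_eq won_by_Box_def won_by_Diamond_tail
        less_upto_tuple_iff eq_upto_tuple_iff split: if_splits)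
  moreover have "count \<pi> ?p = (if even ?p then ?b ?p else Suc (?b ?p))"
    using count_Suc assms(1,2) by (auto simp: count_def)
  moreover have below: "agree ?p (count \<pi>) ?b"
    unfolding agree_def by (metis count_tail less_one)
  \<comment> \<open>In the odd case raising entry \<open>?p\<close> by one turns the strict
    comparison for the tail into a weak one for the play.\<close>
  ultimately have *: "lexlt (Suc ?p) (count \<pi>) a \<or> agree (Suc ?p) (count \<pi>) a"
    unfolding lexlt_Suc
    by (auto simp: agree_def less_Suc_eq lexlt_def split: if_splits)
  have "lexlt (dim G) (count \<pi>) a \<or> agree (dim G) (count \<pi>) a"
    using lexle_extend_zero[OF *] p count_above by (simp add: Suc_le_eq)
  then show ?thesis
    using assms(1,2) by (simp add: value_Diamond_eq won_by_Box_def a tuple_le_iff)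
qed simp

text \<open>The tail starts at an occurrence of the least recurring priority \<open>p\<close>, which
  is even, after which nothing smaller occurs. Entries above \<open>p\<close> are cut off by the
  first vertex; odd priorities below \<open>p\<close> are never visited.\<close>

lemma value_zero_infinitely_often:
  assumes "play G \<pi>" "won_by_Diamond G \<pi>"
  obtains n where "value_Diamond G (tail n \<pi>) = tuple (\<lambda>_. 0)"
proof -
  obtain p where p: "\<exists>\<^sub>\<infinity>n. prio G (\<pi> n) = p" "\<forall>\<^sub>\<infinity>n. p \<le> prio G (\<pi> n)"
    "won_by_Diamond G \<pi> \<longleftrightarrow> even p"
    using liminf_prio assms(1) by metis
  then obtain N where N: "\<And>n. N \<le> n \<Longrightarrow> p \<le> prio G (\<pi> n)"
    by (auto simp: MOST_nat_le)
  from p(1) obtain n where n: "N \<le> n" "prio G (\<pi> n) = p"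
    by (auto simp: INFM_nat_le)
  have "count (tail n \<pi>) i = 0" for i
  proof (cases "p < i")
    case True
    then show ?thesis using n by (intro count_above) (simp add: tail_def)
  next
    case False
    then have "odd i \<Longrightarrow> i < p" using p(3) assms(2) by (cases "i = p") auto
    moreover have "visits i (tail n \<pi>) = {}" if "i < p"
    proof -
      have "prio G (\<pi> (k + n)) \<noteq> i" for k
        using N[of "k + n"] n(1) that by auto
      then show ?thesis by (auto simp: visits_def tail_def)
    qed
    ultimately show ?thesis by (auto simp: count_def)
  qed
  then have "count (tail n \<pi>) = (\<lambda>_. 0)" by (rule ext)
  then have "value_Diamond G (tail n \<pi>) = tuple (\<lambda>_. 0)"
    using assms play_tail by (simp add: value_Diamond_eq won_by_Box_def won_by_Diamond_tail)
  then show thesis by (rule that)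
qed

section \<open>Diamond follows a progress measure\<close>

text \<open>If the least recurring priority \<open>p\<close> were odd, the tuples truncated to
  positions \<open>0..p\<close> would eventually never increase and would strictly decrease at each
  occurrence of \<open>p\<close>, against well-foundedness.\<close>

lemma progress_won_by_Diamond:
  assumes "play G \<pi>" "\<And>n. \<mu> n \<in> ext_pmeasures G" "\<And>n. \<mu> n \<noteq> Top"
    and prog: "\<And>n. progresses (prio G (\<pi> n)) (\<mu> (Suc n)) (\<mu> n)"
  shows "won_by_Diamond G \<pi>"
proof (rule ccontr)
  assume "\<not> won_by_Diamond G \<pi>"
  then obtain p where p: "\<exists>\<^sub>\<infinity>n. prio G (\<pi> n) = p" "\<forall>\<^sub>\<infinity>n. p \<le> prio G (\<pi> n)" "odd p"
    using liminf_prio assms(1) by metis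
  then obtain N where N: "\<And>n. N \<le> n \<Longrightarrow> p \<le> prio G (\<pi> n)"
    by (auto simp: MOST_nat_le)
  have "\<exists>a. \<mu> n = tuple a" for n
    using assms(2,3) ext_pmeasures_cases by metis
  then obtain a where a: "\<And>n. \<mu> n = tuple (a n)" by metis
  have d: "prio G (\<pi> n) < dim G" for n
    using assms(1) play_verts prio_less_dim by auto
  have descent: "lexlt (Suc (prio G (\<pi> n))) (a (Suc n)) (a n) \<or>
      even (prio G (\<pi> n)) \<and> agree (Suc (prio G (\<pi> n))) (a (Suc n)) (a n)" for n
    using prog[of n] d[of n] unfolding a
    by (auto simp: progresses_def le_upto_def less_upto_tuple_iff eq_upto_tuple_iff split: if_splits)
  define R where "R = {(b, c). lexlt (Suc p) b c}"
  have "(map b [0..<Suc p], map c [0..<Suc p]) \<in> lex less_than \<longleftrightarrow> lexlt (Suc p) b c" for b c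
    by (subst lex_less_than_iff) (auto intro!: lexlt_cong simp del: upt_Suc)
  then have "R = inv_image (lex less_than) (\<lambda>b. map b [0..<Suc p])"
    by (auto simp: R_def simp del: upt_Suc)
  then have "wf R" by (simp add: wf_lex)
  \<comment> \<open>\<open>c\<close> is minimal for the truncated order among the tuples from
    \<open>N\<close> on. After its position \<open>n\<close> the truncated tuples can neither rise
    nor fall below it, so they are constant.\<close>
  then obtain c where c: "c \<in> a ` {N..}" "\<And>b. (b, c) \<in> R \<Longrightarrow> b \<notin> a ` {N..}"
    using wfE_min[of R "a N" "a ` {N..}"] by auto
  then obtain n where n: "N \<le> n" "c = a n" by auto
  have eq: "agree (Suc p) (a m) (a n)" if "n \<le> m" for m
    using that
  proof (induction m rule: dec_induct)
    case (step m)
    have "lexlt (Suc p) (a (Suc m)) (a m) \<or> agree (Suc p) (a (Suc m)) (a m)"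
      using descent[of m] N[of m] step(1) n(1)
      by (auto dest: lexlt_truncate[where e = "Suc p"] agree_mono[where e = "Suc p"])
    moreover have "\<not> lexlt (Suc p) (a (Suc m)) (a n)"
      using c(2)[of "a (Suc m)"] n step(1) by (auto simp: R_def)
    ultimately show ?case
      using step(3) lexlt_agree agree_trans by blast
  qed (simp add: agree_def)
  from p(1) obtain m where m: "n \<le> m" "prio G (\<pi> m) = p"
    by (auto simp: INFM_nat_le)
  with descent[of m] p(3) have "lexlt (Suc p) (a (Suc m)) (a m)" by auto
  then show False
    using eq[of m] eq[of "Suc m"] m(1) agree_sym agree_trans lexlt_irrefl by (metis le_SucI)
qed

text \<open>A measure below \<open>Top\<close> stays so along the play; hence Diamond wins, some
  tail has the zero value, and the bound moves backwards from there one vertex at a time.\<close>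

lemma progress_value_le:
  assumes "play G \<pi>" "\<And>n. \<mu> n \<in> ext_pmeasures G"
    and prog: "\<And>n. progresses (prio G (\<pi> n)) (\<mu> (Suc n)) (\<mu> n)"
  shows "value_Diamond G \<pi> \<le> \<mu> 0"
proof (cases "\<mu> 0 = Top")
  case False
  have "\<mu> n \<noteq> Top" for n
  proof (induction n)
    case (Suc n)
    then obtain a where "\<mu> n = tuple a"
      using assms(2) ext_pmeasures_cases by metis
    with prog[of n] show ?case
      by (auto simp: progresses_def le_upto_def split: if_splits)
  qed (fact False)
  then have won: "won_by_Diamond G \<pi>"
    using progress_won_by_Diamond assms by blast
  obtain N where "value_Diamond G (tail N \<pi>) = tuple (\<lambda>_. 0)"
    using value_zero_infinitely_often assms(1) won by metis
  then have base: "value_Diamond G (tail N \<pi>) \<le> \<mu> N"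
    using assms(2) zero_le by simp
  have "value_Diamond G (tail 0 \<pi>) \<le> \<mu> 0"
    using le0[of N] base
  proof (induction rule: inc_induct)
    case (step n)
    show ?case
      by (rule value_le_of_progresses[where n = "\<mu> (Suc n)"])
         (use step assms won prog in \<open>simp_all add: play_tail won_by_Diamond_tail tail_tail
            tail_apply[of n \<pi> 0]\<close>)
  qed
  then show ?thesis by (simp add: tail_def)
qed simp

section \<open>What Box can force\<close>

text \<open>Box strategies are total here, on arbitrary nonempty lists and whoever owns the last
  vertex. Legality thus survives cutting off or prepending a piece of history.\<close>

definition legal :: "('v list \<Rightarrow> 'v) \<Rightarrow> bool" where
  "legal f \<longleftrightarrow> (\<forall>h. h \<noteq> [] \<longrightarrow> last h \<in> verts G \<longrightarrow> f h \<in> succs G (last h))"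

definition follows :: "('v list \<Rightarrow> 'v) \<Rightarrow> (nat \<Rightarrow> 'v) \<Rightarrow> bool" where
  "follows f \<pi> \<longleftrightarrow> play G \<pi> \<and>
     (\<forall>n. \<pi> n \<in> owned G Box \<longrightarrow> \<pi> (Suc n) = f (map \<pi> [0..<Suc n]))"

definition forced :: "'v \<Rightarrow> ((nat \<Rightarrow> 'v) \<Rightarrow> bool) \<Rightarrow> bool" where
  "forced v P \<longleftrightarrow> (\<exists>f. legal f \<and> (\<forall>\<pi>. follows f \<pi> \<longrightarrow> \<pi> 0 = v \<longrightarrow> P \<pi>))"

section \<open>Composition of strategies of Box\<close>

lemma forced_mono: "forced v P \<Longrightarrow> (\<And>\<pi>. play G \<pi> \<Longrightarrow> P \<pi> \<Longrightarrow> Q \<pi>) \<Longrightarrow> forced v Q"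
  unfolding forced_def follows_def by blast

lemma legal_succ: "legal (\<lambda>h. SOME w. w \<in> succs G (last h))"
  using succs_nonempty by (auto simp: legal_def intro: someI_ex)

lemma forced_trivial: "(\<And>\<pi>. play G \<pi> \<Longrightarrow> P \<pi>) \<Longrightarrow> forced v P"
  using legal_succ unfolding forced_def follows_def by blast

lemma map_tail: "map (tail k \<pi>) [0..<m] = map \<pi> [k..<k + m]"
  by (intro nth_equalityI) (auto simp: tail_def add.commute)

text \<open>Box moves to \<open>w\<close> if it owns \<open>v\<close>, otherwise awaits the
  opponent's choice, and then uses the strategy of the vertex reached with \<open>v\<close> dropped
  from the history.\<close>

lemma forced_first_move:
  assumes w: "w \<in> succs G v"
    and forced: "\<And>u. u \<in> succs G v \<Longrightarrow> v \<notin> owned G Box \<or> u = w \<Longrightarrow> forced u P"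
  shows "forced v (\<lambda>\<pi>. P (tail 1 \<pi>))"
proof -
  have "\<exists>f. legal f \<and> (u \<in> succs G v \<and> (v \<notin> owned G Box \<or> u = w) \<longrightarrow>
      (\<forall>\<pi>. follows f \<pi> \<longrightarrow> \<pi> 0 = u \<longrightarrow> P \<pi>))" for u
    using forced legal_succ unfolding forced_def by metis
  then obtain F where F: "\<And>u. legal (F u)"
    "\<And>u \<pi>. u \<in> succs G v \<Longrightarrow> v \<notin> owned G Box \<or> u = w \<Longrightarrow> follows (F u) \<pi> \<Longrightarrow> \<pi> 0 = u \<Longrightarrow> P \<pi>"
    by metis
  \<comment> \<open>A one-vertex history calls for the first move; in a longer one
    \<open>h ! 1\<close> is the vertex reached by it and selects the strategy for
    \<open>tl h\<close>.\<close>
  define f where "f h = (if tl h = [] then if last h = v then w else SOME w. w \<in> succs G (last h)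
      else F (h ! 1) (tl h))" for h
  have "legal f"
    unfolding legal_def
  proof (intro allI impI)
    fix h :: "'v list" assume h: "h \<noteq> []" "last h \<in> verts G"
    show "f h \<in> succs G (last h)"
    proof (cases "tl h = []")
      case True
      then show ?thesis using w h legal_succ by (auto simp: f_def legal_def)
    next
      case False
      then show ?thesis using F(1) h by (metis f_def last_tl legal_def)
    qed
  qed
  moreover have "P (tail 1 \<pi>)" if \<pi>: "follows f \<pi>" "\<pi> 0 = v" for \<pi>
  proof (rule F(2))
    show "tail 1 \<pi> 0 \<in> succs G v"
      using \<pi> by (auto simp: follows_def play_def tail_def)
    show "v \<notin> owned G Box \<or> tail 1 \<pi> 0 = w"
      using \<pi> by (auto simp: follows_def f_def tail_def)
    have "tl (map \<pi> [0..<Suc (Suc n)]) = map (tail 1 \<pi>) [0..<Suc n]" for n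
      by (simp add: map_tail map_tl[symmetric] del: upt_Suc)
    moreover have "map \<pi> [0..<Suc (Suc n)] ! 1 = \<pi> 1" for n
      by (simp del: upt_Suc)
    ultimately have "f (map \<pi> [0..<Suc (Suc n)]) = F (\<pi> 1) (map (tail 1 \<pi>) [0..<Suc n])" for n
      by (simp add: f_def del: upt_Suc)
    then show "follows (F (tail 1 \<pi> 0)) (tail 1 \<pi>)"
      using \<pi>(1) play_tail[of \<pi> 1] unfolding follows_def by (auto simp: tail_def simp del: upt_Suc)
  qed simp
  ultimately show ?thesis
    unfolding forced_def by blast
qed

text \<open>The continuation strategy prepends the first \<open>k\<close> vertices of
  \<open>\<pi>\<close> to the history, so the spliced play follows \<open>f\<close> throughout.
  Agreement of \<open>\<pi>\<close> with \<open>f\<close> is asked only before \<open>k\<close>,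
  because a restarting strategy may abandon \<open>f\<close> there.\<close>

lemma forced_residual:
  assumes "legal f" "play G \<pi>"
    and cons: "\<And>m. m < k \<Longrightarrow> \<pi> m \<in> owned G Box \<Longrightarrow> \<pi> (Suc m) = f (map \<pi> [0..<Suc m])"
    and P: "\<And>\<pi>'. follows f \<pi>' \<Longrightarrow> \<pi>' 0 = \<pi> 0 \<Longrightarrow> P \<pi>'"
  shows "forced (\<pi> k) (\<lambda>\<pi>'. P (\<lambda>j. if j < k then \<pi> j else \<pi>' (j - k)))"
proof -
  define f' where "f' h = f (map \<pi> [0..<k] @ h)" for h
  have "legal f'"
    using assms(1) by (auto simp: legal_def f'_def)
  moreover have "P (\<lambda>j. if j < k then \<pi> j else \<pi>' (j - k))"
    if \<pi>': "follows f' \<pi>'" "\<pi>' 0 = \<pi> k" for \<pi>'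
  proof -
    define c where "c = (\<lambda>j. if j < k then \<pi> j else \<pi>' (j - k))"
    have low: "c j = \<pi> j" if "j \<le> k" for j
      using that \<pi>'(2) by (auto simp: c_def)
    have "c n \<in> verts G \<and> c (Suc n) \<in> succs G (c n) \<and>
        (c n \<in> owned G Box \<longrightarrow> c (Suc n) = f (map c [0..<Suc n]))" for n
    proof (cases "n < k")
      case True
      then have "map c [0..<Suc n] = map \<pi> [0..<Suc n]"
        using low by (auto simp del: upt_Suc)
      moreover have "c n = \<pi> n" "c (Suc n) = \<pi> (Suc n)"
        using True low by simp_all
      ultimately show ?thesis
        using assms(2) cons[OF True] by (simp add: play_def del: upt_Suc map_eq_conv)
    next
      case False
      have "map c [0..<Suc n] = map \<pi> [0..<k] @ map \<pi>' [0..<Suc (n - k)]"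
        using False by (intro nth_equalityI) (auto simp: c_def nth_append simp del: upt_Suc)
      moreover have "c n = \<pi>' (n - k)" "c (Suc n) = \<pi>' (Suc (n - k))"
        using False by (auto simp: c_def Suc_diff_le)
      ultimately show ?thesis
        using \<pi>'(1) by (simp add: follows_def play_def f'_def del: upt_Suc)
    qed
    then have "follows f c"
      unfolding follows_def play_def by blast
    then have "P c"
      using low by (intro P) auto
    then show ?thesis by (simp add: c_def)
  qed
  ultimately show ?thesis
    unfolding forced_def by blast
qed

section \<open>Lexicographic targets and the pumping argument\<close>

definition exceeds :: "nat \<Rightarrow> (nat \<Rightarrow> nat) \<Rightarrow> (nat \<Rightarrow> 'v) \<Rightarrow> bool" where
  "exceeds i a \<pi> \<longleftrightarrow> won_by_Box G \<pi> \<or> lexlt i a (count \<pi>)"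

text \<open>At the extremes, \<open>exceeds 0 a\<close> says that Box wins and
  \<open>exceeds (dim G) a\<close> that the value is above \<open>tuple a\<close>. Here entry
  \<open>i\<close> gets a free threshold \<open>n\<close> in place of \<open>a i\<close>, so that
  thresholds beyond the bound can be studied.\<close>

definition reaches :: "nat \<Rightarrow> (nat \<Rightarrow> nat) \<Rightarrow> nat \<Rightarrow> (nat \<Rightarrow> 'v) \<Rightarrow> bool" where
  "reaches i a n \<pi> \<longleftrightarrow> exceeds i a \<pi> \<or> agree i a (count \<pi>) \<and> n \<le> count \<pi> i"

lemma exceeds_tail:
  assumes "\<And>m. m < k \<Longrightarrow> i \<le> prio G (\<pi> m)"
  shows "exceeds i a (tail k \<pi>) = exceeds i a \<pi>"
proof -
  have "count \<pi> j = count (tail k \<pi>) j" if "j < i" for j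
    using assms that by (intro count_tail) (meson order_less_le_trans)
  then have "lexlt i a (count (tail k \<pi>)) = lexlt i a (count \<pi>)"
    by (intro lexlt_cong) auto
  then show ?thesis by (simp add: exceeds_def won_by_Box_tail)
qed

lemma reaches_tail:
  assumes "\<And>m. m < k \<Longrightarrow> i < prio G (\<pi> m)"
  shows "reaches i a n (tail k \<pi>) = reaches i a n \<pi>"
proof -
  have "count \<pi> j = count (tail k \<pi>) j" if "j \<le> i" for j
    using assms that by (intro count_tail) (meson order_le_less_trans)
  then have "agree i a (count (tail k \<pi>)) = agree i a (count \<pi>)" "count (tail k \<pi>) i = count \<pi> i"
    by (auto simp: agree_def)
  moreover have "exceeds i a (tail k \<pi>) = exceeds i a \<pi>"
    using assms by (intro exceeds_tail) (simp add: less_imp_le)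
  ultimately show ?thesis by (simp add: reaches_def)
qed

lemma reaches_Suc:
  assumes "play G \<pi>" "odd i" "prio G (\<pi> 0) = i" "reaches i a (Suc n) \<pi>"
  shows "reaches i a n (tail 1 \<pi>)"
proof -
  have ex: "exceeds i a (tail 1 \<pi>) = exceeds i a \<pi>"
    using assms(3) by (intro exceeds_tail) simp
  show ?thesis
  proof (cases "exceeds i a \<pi>")
    case False
    then have "agree i a (count \<pi>)" "Suc n \<le> count \<pi> i" "won_by_Diamond G \<pi>"
      using assms(4) by (auto simp: reaches_def exceeds_def won_by_Box_def)
    moreover have "count \<pi> j = count (tail 1 \<pi>) j" if "j < i" for j
      using assms(3) that by (intro count_tail) simp
    ultimately show ?thesis
      using count_Suc assms by (auto simp: reaches_def agree_def)
  qed (use ex in \<open>simp add: reaches_def\<close>)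
qed

lemma reaches_mono: "reaches i a n \<pi> \<Longrightarrow> m \<le> n \<Longrightarrow> reaches i a m \<pi>"
  by (auto simp: reaches_def)

text \<open>Box restarts at every visit to priority \<open>i\<close> that is made before a smaller priority occurs.
  After any visit the restarted strategy still promises \<open>n\<close> more of them, so the next visit is again to a vertex from which
  \<open>n\<close>, hence \<open>n + 1\<close>, visits can be forced.\<close>

lemma forced_pump:
  assumes "odd i" "n \<ge> 1" "v \<in> verts G"
    and up: "\<And>u. u \<in> verts G \<Longrightarrow> prio G u = i \<Longrightarrow> forced u (reaches i a n) \<Longrightarrow>
      forced u (reaches i a (Suc n))"
    and v: "forced v (reaches i a n)"
  shows "forced v (exceeds i a)"
proof -
  \<comment> \<open>At a vertex of priority \<open>i\<close> the promise \<open>Suc n\<close>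
    includes the visit being made there, so \<open>n\<close> further visits remain.\<close>
  let ?n = "\<lambda>u. if prio G u = i then Suc n else n"
  have "\<exists>g. legal g \<and> (u \<in> verts G \<and> forced u (reaches i a n) \<longrightarrow>
      (\<forall>\<pi>. follows g \<pi> \<longrightarrow> \<pi> 0 = u \<longrightarrow> reaches i a (?n u) \<pi>))" for u
    using up[of u] legal_succ unfolding forced_def by (cases "prio G u = i") (simp; metis)+
  then obtain g where g: "\<And>u. legal (g u)"
    "\<And>u \<pi>. u \<in> verts G \<Longrightarrow> forced u (reaches i a n) \<Longrightarrow> follows (g u) \<pi> \<Longrightarrow> \<pi> 0 = u \<Longrightarrow>
      reaches i a (?n u) \<pi>"
    by metis
  \<comment> \<open>The last visit in the history, where the current strategy was started; the
    default \<open>0\<close> covers the time before the first visit, as \<open>v\<close> may have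
    another priority.\<close>
  define start where "start h = Max (insert 0 {k. k < length h \<and> prio G (h ! k) = i \<and>
      (\<forall>j\<le>k. i \<le> prio G (h ! j))})" for h :: "'v list"
  define f where "f h = g (h ! start h) (drop (start h) h)" for h
  have start_less: "start h < length h" if "h \<noteq> []" for h
    using that unfolding start_def by (subst Max_less_iff) auto
  then have "legal f"
    using g(1) unfolding legal_def f_def by (metis drop_eq_Nil last_drop not_le)
  moreover have "exceeds i a \<pi>" if \<pi>: "follows f \<pi>" "\<pi> 0 = v" for \<pi>
  proof -
    have play: "play G \<pi>" using \<pi>(1) by (simp add: follows_def)
    define A where "A = insert 0 (visits i \<pi>)"
    have start: "start (map \<pi> [0..<Suc m]) = Max (A \<inter> {..m})" for m
    proof -
      have "{k. k < Suc m \<and> prio G (map \<pi> [0..<Suc m] ! k) = i \<and>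
          (\<forall>j\<le>k. i \<le> prio G (map \<pi> [0..<Suc m] ! j))} = visits i \<pi> \<inter> {..m}"
        by (auto simp: visits_def simp del: upt_Suc)
      then show ?thesis by (simp add: start_def A_def del: upt_Suc)
    qed
    have move: "tail K \<pi> (Suc m) = g (\<pi> K) (map (tail K \<pi>) [0..<Suc m])"
      if "K \<in> A" "\<And>k. k \<in> A \<Longrightarrow> k \<le> K + m \<Longrightarrow> k \<le> K" "tail K \<pi> m \<in> owned G Box" for K m
    proof -
      have "Max (A \<inter> {..K + m}) = K"
        using that(1,2) by (intro Max_eqI) auto
      then have "start (map \<pi> [0..<Suc (K + m)]) = K"
        using start by simp
      moreover have "drop K (map \<pi> [0..<Suc (K + m)]) = map (tail K \<pi>) [0..<Suc m]"
        by (simp add: map_tail drop_map drop_upt del: upt_Suc)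
      moreover have "map \<pi> [0..<Suc (K + m)] ! K = \<pi> K"
        by (simp del: upt_Suc)
      moreover have "\<pi> (Suc (K + m)) = f (map \<pi> [0..<Suc (K + m)])"
        using \<pi>(1) that(3) by (simp add: follows_def tail_def add.commute del: upt_Suc)
      ultimately show ?thesis
        by (simp add: f_def tail_def add.commute del: upt_Suc)
    qed
    have forced: "forced (\<pi> k) (reaches i a n)" if "k \<in> A" for k
      using that
    proof (induction k rule: less_induct)
      case (less k)
      show ?case
      proof (cases "k = 0")
        case True
        then show ?thesis using v \<pi>(2) by simp
      next
        case False
        then have k: "k \<in> visits i \<pi>" using less.prems by (simp add: A_def)
        \<comment> \<open>\<open>K\<close> is the previous restart. Strictly between
          \<open>K\<close> and \<open>k\<close> all priorities exceed \<open>i\<close>, so the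
          strategy started at \<open>K\<close> still owes \<open>n\<close> visits at
          \<open>k\<close>.\<close>
        define K where "K = Max (A \<inter> {..<k})"
        have "0 \<in> A \<inter> {..<k}" using False by (simp add: A_def)
        then have "K \<in> A \<inter> {..<k}"
          unfolding K_def by (intro Max_in) auto
        then have K: "K \<in> A" "K < k" by simp_all
        have between: "\<And>j. j \<in> A \<Longrightarrow> j < k \<Longrightarrow> j \<le> K"
          by (simp add: K_def)
        define l where "l = k - K"
        have l: "k = l + K" "0 < l" using K(2) by (auto simp: l_def)
        let ?c = "\<lambda>\<pi>' j. if j < l then tail K \<pi> j else \<pi>' (j - l)"
        have "forced (tail K \<pi> l) (\<lambda>\<pi>'. reaches i a (?n (\<pi> K)) (?c \<pi>'))"
        proof (rule forced_residual)
          show "tail K \<pi> (Suc m) = g (\<pi> K) (map (tail K \<pi>) [0..<Suc m])"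
            if "m < l" "tail K \<pi> m \<in> owned G Box" for m
            using that K(1) between l(1) by (intro move) auto
          show "reaches i a (?n (\<pi> K)) \<pi>'" if "follows (g (\<pi> K)) \<pi>'" "\<pi>' 0 = tail K \<pi> 0" for \<pi>'
            using that g(2) less.IH K play_verts play by (simp add: tail_def)
        qed (use g(1) play play_tail in auto)
        \<comment> \<open>Forcing concerns only plays that start in \<open>\<pi> k\<close>;
          recording this makes the splice fit at position \<open>l\<close>.\<close>
        then have "forced (\<pi> k) (\<lambda>\<pi>'. reaches i a (?n (\<pi> K)) (?c \<pi>') \<and> \<pi>' 0 = \<pi> k)"
          unfolding l(1) by (simp add: tail_def forced_def)
        then show ?thesis
        proof (rule forced_mono, elim conjE)
          fix \<pi>' assume \<pi>': "play G \<pi>'" "reaches i a (?n (\<pi> K)) (?c \<pi>')" "\<pi>' 0 = \<pi> k"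
          have c: "?c \<pi>' m = \<pi> (m + K)" if "m \<le> l" for m
            using that \<pi>'(3) l(1) by (auto simp: tail_def)
          have above: "i < prio G (\<pi> j)" if "K < j \<or> (j = K \<and> prio G (\<pi> K) \<noteq> i)" "j < k" for j
          proof -
            have "i \<le> prio G (\<pi> j)" using k that(2) by (simp add: visits_def)
            moreover have "prio G (\<pi> j) \<noteq> i"
              using that between[of j] k by (auto simp: A_def visits_def)
            ultimately show ?thesis by simp
          qed
          have tl: "tail l (?c \<pi>') = \<pi>'" by (auto simp: tail_def)
          show "reaches i a n \<pi>'"
          proof (cases "prio G (\<pi> K) = i")
            case False
            have "i < prio G (?c \<pi>' m)" if "m < l" for m
              using above[of "m + K"] False that l(1) by (cases "m = 0") (auto simp: tail_def)
            then have "reaches i a n (tail l (?c \<pi>'))"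
              using \<pi>'(2) False by (subst reaches_tail) simp_all
            then show ?thesis by (simp only: tl)
          next
            case True
            have "play G (?c \<pi>')"
            proof -
              have "?c \<pi>' m \<in> verts G \<and> ?c \<pi>' (Suc m) \<in> succs G (?c \<pi>' m)" for m
              proof (cases "m < l")
                case True
                then show ?thesis using c[of m] c[of "Suc m"] play by (simp add: play_def)
              next
                case False
                then show ?thesis using \<pi>'(1) by (simp add: play_def Suc_diff_le)
              qed
              then show ?thesis by (simp add: play_def)
            qed
            moreover have "prio G (?c \<pi>' 0) = i" using True c[of 0] by simp
            ultimately have "reaches i a n (tail 1 (?c \<pi>'))"
              using \<pi>'(2) True assms(1) by (intro reaches_Suc) auto
            moreover have "i < prio G (tail 1 (?c \<pi>') m)" if "m < l - 1" for m
            proof -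
              have "tail 1 (?c \<pi>') m = \<pi> (Suc m + K)"
                using c[of "Suc m"] that by (auto simp: tail_def)
              then show ?thesis using above[of "Suc m + K"] that l(1) by simp
            qed
            ultimately have "reaches i a n (tail (l - 1) (tail 1 (?c \<pi>')))"
              by (subst reaches_tail) auto
            then show ?thesis using l(2) tl by (simp add: tail_tail)
          qed
        qed
      qed
    qed
    show ?thesis
    proof (cases "finite A")
      case False
      then have "won_by_Box G \<pi>"
        using infinite_visits_won_by_Box play assms(1) by (simp add: A_def)
      then show ?thesis by (simp add: exceeds_def)
    next
      case True
      define K where "K = Max A"
      have K: "K \<in> A" "\<And>k. k \<in> A \<Longrightarrow> k \<le> K"
        using True Max_in[of A] by (auto simp: K_def A_def)
      have "follows (g (\<pi> K)) (tail K \<pi>)"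
        unfolding follows_def using play play_tail move K by blast
      then have reach: "reaches i a (?n (\<pi> K)) (tail K \<pi>)"
        using g(2) forced[OF K(1)] play_verts play by (simp add: tail_def)
      have low: "i \<le> prio G (\<pi> m)" if "m < K" for m
        using K(1) that by (auto simp: A_def visits_def)
      have "k = 0" "prio G (\<pi> K) = i" if "k \<in> visits i (tail K \<pi>)" for k
      proof -
        have k: "prio G (\<pi> (k + K)) = i" "\<And>j. j \<le> k \<Longrightarrow> i \<le> prio G (\<pi> (j + K))"
          using that by (auto simp: visits_def tail_def)
        have "i \<le> prio G (\<pi> m)" if "m \<le> k + K" for m
          using low[of m] k(2)[of "m - K"] that by (cases "m < K") auto
        with k(1) have "k + K \<in> visits i \<pi>" by (simp add: visits_def)
        then show "k = 0" using K(2)[of "k + K"] by (simp add: A_def)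
        with k(1) show "prio G (\<pi> K) = i" by simp
      qed
      \<comment> \<open>After the last restart the only possible visit is the one made at
        \<open>K\<close> itself. As \<open>n \<ge> 1\<close>, the promised number is missed, so the
        target must be exceeded below \<open>i\<close>.\<close>
      then have "visits i (tail K \<pi>) \<subseteq> (if prio G (\<pi> K) = i then {0} else {})"
        by auto
      then have "card (visits i (tail K \<pi>)) < ?n (\<pi> K)"
        using assms(2) card_mono[of "{0}" "visits i (tail K \<pi>)"] by (auto split: if_splits)
      then have "exceeds i a (tail K \<pi>)"
        using reach by (auto simp: reaches_def count_def split: if_splits)
      then show ?thesis
        using exceeds_tail low by blast
    qed
  qed
  ultimately show ?thesis
    unfolding forced_def by blast
qed

text \<open>The sets \<open>W n\<close> decrease within the vertices of priority \<open>i\<close>,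
  so for some \<open>n \<le> card (verts_of_prio G i)\<close> the step to \<open>W (Suc n)\<close>
  loses nothing, and \<open>forced_pump\<close> applies there.\<close>

lemma forced_overflow:
  assumes "odd i" "v \<in> verts G"
    and v: "forced v (reaches i a (Suc (card (verts_of_prio G i))))"
  shows "forced v (exceeds i a)"
proof -
  \<comment> \<open>The shift to \<open>Suc n\<close> meets the pump's requirement of at least one
    promised visit.\<close>
  define W where "W n = {u \<in> verts_of_prio G i. forced u (reaches i a (Suc n))}" for n
  let ?c = "card (verts_of_prio G i)"
  have fin: "finite (verts_of_prio G i)"
    using finite_verts by (simp add: verts_of_prio_def)
  have anti: "W (Suc n) \<subseteq> W n" for n
    using forced_mono reaches_mono unfolding W_def by (smt (verit) Collect_mono le_SucI order_refl)
  have "\<exists>n\<le>?c. W n \<subseteq> W (Suc n)"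
  proof (rule ccontr)
    assume no: "\<not> (\<exists>n\<le>?c. W n \<subseteq> W (Suc n))"
    have "card (W n) + n \<le> ?c" if "n \<le> Suc ?c" for n
      using that
    proof (induction n)
      case 0
      then show ?case using fin by (auto simp: W_def intro: card_mono)
    next
      case (Suc n)
      have "\<not> W n \<subseteq> W (Suc n)" using no Suc.prems by simp
      then have "W (Suc n) \<subset> W n" using anti[of n] by auto
      then have "card (W (Suc n)) < card (W n)"
        using fin by (intro psubset_card_mono) (auto simp: W_def)
      with Suc show ?case by simp
    qed
    from this[of "Suc ?c"] show False by simp
  qed
  then obtain n where n: "n \<le> ?c" "W n \<subseteq> W (Suc n)" by blast
  show ?thesis
  proof (rule forced_pump)
    show "forced u (reaches i a (Suc (Suc n)))"
      if "u \<in> verts G" "prio G u = i" "forced u (reaches i a (Suc n))" for u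
      using that n(2) by (auto simp: W_def verts_of_prio_def)
    show "forced v (reaches i a (Suc n))"
      using v n(1) by (elim forced_mono) (auto intro: reaches_mono)
  qed (use assms in auto)
qed

text \<open>A maximal forceable \<open>m\<close> exists by finiteness, but maximality speaks of
  bounded measures while values are unbounded; \<open>forced_overflow\<close> closes this
  gap.\<close>

lemma best_forced_measure:
  assumes "v \<in> verts G"
  obtains m where "m \<in> pmeasures G" "forced v (\<lambda>\<pi>. m \<le> value_Diamond G \<pi>)"
    "m \<noteq> Top \<Longrightarrow> \<not> forced v (\<lambda>\<pi>. m < value_Diamond G \<pi>)"
proof -
  define S where "S = {m \<in> pmeasures G. forced v (\<lambda>\<pi>. m \<le> value_Diamond G \<pi>)}"
  have "tuple (\<lambda>_. 0) \<le> value_Diamond G \<pi>" for \<pi>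
    using zero_le value_Diamond_in_ext_pmeasures by blast
  then have "tuple (\<lambda>_. 0) \<in> S"
    by (auto simp: S_def tuple_pmeasures_iff intro: forced_trivial)
  then obtain m where m: "m \<in> S" "\<And>y. y \<in> S \<Longrightarrow> m \<le> y \<Longrightarrow> m = y"
    using finite_has_maximal[of S] finite_pmeasures by (auto simp: S_def)
  have "\<not> forced v (\<lambda>\<pi>. m < value_Diamond G \<pi>)" if "m \<noteq> Top"
  proof
    assume forced: "forced v (\<lambda>\<pi>. m < value_Diamond G \<pi>)"
    have "m \<in> ext_pmeasures G" using m(1) pmeasures_subset by (auto simp: S_def)
    then obtain x where x: "m = tuple x" "\<And>k. even k \<Longrightarrow> x k = 0"
      using \<open>m \<noteq> Top\<close> by (elim ext_pmeasures_cases) auto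
    \<comment> \<open>Induction on the number of compared positions, from Box winning outright at
      \<open>0\<close> to values above \<open>m\<close> at \<open>dim G\<close>.\<close>
    have "\<not> forced v (exceeds j x)" if "j \<le> dim G" for j
      using that
    proof (induction j)
      case 0
      show ?case
      proof
        assume "forced v (exceeds 0 x)"
        then have "forced v (\<lambda>\<pi>. Top \<le> value_Diamond G \<pi>)"
          by (rule forced_mono) (simp add: exceeds_def lexlt_def value_Diamond_eq)
        then have "Top \<in> S" using Top_pmeasures by (simp add: S_def)
        with m(2) \<open>m \<noteq> Top\<close> show False by auto
      qed
    next
      case (Suc j)
      show ?case
      proof
        assume forced: "forced v (exceeds (Suc j) x)"
        \<comment> \<open>An even position never contributes. An odd one either has room for a
          larger bounded tuple, or is full, and then exceeding \<open>x j\<close> overflows the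
          bound.\<close>
        consider "even j" | "odd j" "Suc (x j) \<le> card (verts_of_prio G j)"
          | "odd j" "card (verts_of_prio G j) \<le> x j" by linarith
        then show False
        proof cases
          case 1
          have "forced v (exceeds j x)"
            using forced
            by (rule forced_mono) (use 1 in \<open>auto simp: exceeds_def lexlt_Suc count_def\<close>)
          with Suc show False by simp
        next
          case 2
          \<comment> \<open>The least tuple whose first difference from \<open>x\<close> is an
            increase at \<open>j\<close>; by the zeros after \<open>j\<close> it bounds from below
            every value that exceeds \<open>x\<close> on the first \<open>Suc j\<close>
            positions.\<close>
          define y where "y k = (if k < j then x k else if k = j then Suc (x j) else 0)" for k
          have y_le: "tuple y \<le> value_Diamond G \<pi>" if "play G \<pi>" "exceeds (Suc j) x \<pi>" for \<pi>
          proof (cases "won_by_Box G \<pi>")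
            case False
            then have "lexlt (Suc j) x (count \<pi>)" using that(2) by (simp add: exceeds_def)
            moreover have "lexlt j y (count \<pi>) = lexlt j x (count \<pi>)"
              by (intro lexlt_cong) (auto simp: y_def)
            ultimately have "lexlt (Suc j) y (count \<pi>) \<or> agree (Suc j) y (count \<pi>)"
              by (auto simp: lexlt_Suc agree_def y_def less_Suc_eq)
            then have "lexlt (dim G) y (count \<pi>) \<or> agree (dim G) y (count \<pi>)"
              using Suc.prems by (rule lexle_extend_zero) (simp add: y_def)
            then show ?thesis
              using that(1) False by (simp add: value_Diamond_eq tuple_le_iff)
          qed (simp add: that(1) value_Diamond_eq)
          have "forced v (\<lambda>\<pi>. tuple y \<le> value_Diamond G \<pi>)"
            using forced by (rule forced_mono) (rule y_le)
          moreover have "tuple y \<in> pmeasures G"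
            using m(1) 2 x by (auto simp: S_def tuple_pmeasures_iff y_def)
          ultimately have "tuple y \<in> S" by (simp add: S_def)
          moreover have "tuple x < tuple y"
            using Suc.prems by (auto simp: tuple_less_iff lexlt_def y_def intro!: exI[of _ j])
          ultimately show False
            using m(2) x(1) by (metis less_imp_le less_irrefl)
        next
          case 3
          have "forced v (reaches j x (Suc (card (verts_of_prio G j))))"
            using forced
            by (rule forced_mono) (use 3 in \<open>auto simp: exceeds_def reaches_def lexlt_Suc\<close>)
          then have "forced v (exceeds j x)"
            using 3(1) assms by (intro forced_overflow)
          with Suc show False by simp
        qed
      qed
    qed
    moreover have "forced v (exceeds (dim G) x)"
      using forced
      by (rule forced_mono)
         (auto simp: x(1) value_Diamond_eq exceeds_def tuple_less_iff split: if_splits)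
    ultimately show False by blast
  qed
  with m(1) that show thesis by (auto simp: S_def)
qed

text \<open>Where progress failed, one move followed by the best strategies of the successors would
  force a value above \<open>\<mu> v\<close>, against its maximality.\<close>

lemma progress_measure_forced:
  obtains \<mu> where "game_progress_measure G \<mu>"
    "\<And>v. v \<in> verts G \<Longrightarrow> forced v (\<lambda>\<pi>. \<mu> v \<le> value_Diamond G \<pi>)"
proof -
  have "\<exists>m. v \<in> verts G \<longrightarrow> m \<in> pmeasures G \<and> forced v (\<lambda>\<pi>. m \<le> value_Diamond G \<pi>) \<and>
      (m \<noteq> Top \<longrightarrow> \<not> forced v (\<lambda>\<pi>. m < value_Diamond G \<pi>))" for v
  proof (cases "v \<in> verts G")
    case True
    then show ?thesis by (rule best_forced_measure) blast
  qed simp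
  then have "\<exists>\<mu>. \<forall>v. v \<in> verts G \<longrightarrow> \<mu> v \<in> pmeasures G \<and>
      forced v (\<lambda>\<pi>. \<mu> v \<le> value_Diamond G \<pi>) \<and>
      (\<mu> v \<noteq> Top \<longrightarrow> \<not> forced v (\<lambda>\<pi>. \<mu> v < value_Diamond G \<pi>))"
    by (intro choice) blast
  then obtain \<mu> where \<mu>: "\<And>v. v \<in> verts G \<Longrightarrow> \<mu> v \<in> pmeasures G"
    "\<And>v. v \<in> verts G \<Longrightarrow> forced v (\<lambda>\<pi>. \<mu> v \<le> value_Diamond G \<pi>)"
    "\<And>v. v \<in> verts G \<Longrightarrow> \<mu> v \<noteq> Top \<Longrightarrow> \<not> forced v (\<lambda>\<pi>. \<mu> v < value_Diamond G \<pi>)"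
    by blast
  have ext: "\<mu> v \<in> ext_pmeasures G" if "v \<in> verts G" for v
    using \<mu>(1) that pmeasures_subset by blast
  \<comment> \<open>Both owners at once: for Box, \<open>w\<close> is a successor where progress
    fails; for Diamond, \<open>w\<close> is any successor and \<open>no\<close> covers all of
    them.\<close>
  have progress: False
    if v: "v \<in> verts G" and w: "w \<in> succs G v"
      and no: "\<And>u. u \<in> succs G v \<Longrightarrow> v \<notin> owned G Box \<or> u = w \<Longrightarrow>
        \<not> progresses (prio G v) (\<mu> u) (\<mu> v)" for v w
  proof -
    let ?P = "\<lambda>\<pi>. \<pi> 0 \<in> succs G v \<and> (v \<notin> owned G Box \<or> \<pi> 0 = w) \<and>
        \<mu> (\<pi> 0) \<le> value_Diamond G \<pi>"
    have "forced u ?P" if "u \<in> succs G v" "v \<notin> owned G Box \<or> u = w" for u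
      using \<mu>(2)[of u] that succs_verts unfolding forced_def by blast
    then have "forced v (\<lambda>\<pi>. ?P (tail 1 \<pi>))"
      using w by (intro forced_first_move)
    then have "forced v (\<lambda>\<pi>. ?P (tail 1 \<pi>) \<and> \<pi> 0 = v)"
      by (auto simp: forced_def)
    then have "forced v (\<lambda>\<pi>. \<mu> v < value_Diamond G \<pi>)"
    proof (rule forced_mono)
      fix \<pi> assume play: "play G \<pi>" and P: "?P (tail 1 \<pi>) \<and> \<pi> 0 = v"
      let ?u = "tail 1 \<pi> 0"
      have u: "?u \<in> verts G" using P succs_verts by blast
      \<comment> \<open>The value progresses from that of its tail, hence from the smaller
        \<open>\<mu> ?u\<close>; were it at most \<open>\<mu> v\<close>, then \<open>\<mu> v\<close>
        would progress from \<open>\<mu> ?u\<close> too.\<close>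
      have "progresses (prio G v) (\<mu> ?u) (value_Diamond G \<pi>)"
        using le_progresses value_tail_progresses[OF play] P prio_less_dim[OF v] ext[OF u]
          value_Diamond_in_ext_pmeasures by metis
      moreover have "\<not> progresses (prio G v) (\<mu> ?u) (\<mu> v)"
        using no P by blast
      ultimately have "\<not> value_Diamond G \<pi> \<le> \<mu> v"
        using progresses_le_upto le_imp_le_upto prio_less_dim[OF v] ext[OF u] ext[OF v]
          value_Diamond_in_ext_pmeasures by metis
      then show "\<mu> v < value_Diamond G \<pi>"
        using ext_pmeasures_linear ext[OF v] value_Diamond_in_ext_pmeasures by blast
    qed
    then have "\<mu> v = Top" using \<mu>(3) v by blast
    then show False
      using no[OF w] progresses_Top ext succs_verts[OF w] by auto
  qed
  have "game_progress_measure G \<mu>"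
    unfolding game_progress_measure_iff
  proof (intro conjI ballI)
    fix v assume v: "v \<in> owned G Diamond"
    then have "v \<in> verts G" using owned_verts by blast
    then show "\<exists>w\<in>succs G v. progresses (prio G v) (\<mu> w) (\<mu> v)"
      using progress succs_nonempty by metis
  next
    fix v w assume v: "v \<in> owned G Box" "w \<in> succs G v"
    then have "v \<in> verts G" using owned_verts by blast
    with v show "progresses (prio G v) (\<mu> w) (\<mu> v)"
      using progress by metis
  qed (rule \<mu>(1))
  with \<mu>(2) that show thesis by blast
qed

section \<open>Strategies\<close>

lemma finite_path_stretch: "play G \<pi> \<Longrightarrow> finite_path G (stretch \<pi> 0 n)"
  unfolding finite_path_def stretch_def successively_conv_nth
  by (auto simp: play_def simp del: upt_Suc)

lemma last_stretch: "last (stretch \<pi> 0 n) = \<pi> n"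
  by (simp add: stretch_def)

lemma finite_path_last: "finite_path G h \<Longrightarrow> h \<noteq> [] \<and> last h \<in> verts G"
  by (auto simp: finite_path_def)

lemma forced_strategy:
  assumes "forced v P"
  obtains \<sigma> where "strategy G Box \<sigma>"
    "\<And>\<pi>. play G \<pi> \<Longrightarrow> \<pi> 0 = v \<Longrightarrow> consistent \<sigma> \<pi> \<Longrightarrow> P \<pi>"
proof -
  obtain f where f: "legal f" "\<And>\<pi>. follows f \<pi> \<Longrightarrow> \<pi> 0 = v \<Longrightarrow> P \<pi>"
    using assms unfolding forced_def by blast
  define \<sigma> where "\<sigma> h = (if finite_path G h \<and> last h \<in> owned G Box then Some (f h) else None)" for h
  have "strategy G Box \<sigma>"
    using f(1) finite_path_last unfolding strategy_def legal_def
    by (auto simp: \<sigma>_def split: if_splits)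
  moreover have "follows f \<pi>" if "play G \<pi>" "consistent \<sigma> \<pi>" for \<pi>
    unfolding follows_def
  proof (intro conjI allI impI)
    fix n assume "\<pi> n \<in> owned G Box"
    then have "\<sigma> (stretch \<pi> 0 n) = Some (f (stretch \<pi> 0 n))"
      using finite_path_stretch that(1) by (simp add: \<sigma>_def last_stretch)
    with that(2) have "\<pi> (Suc n) = f (stretch \<pi> 0 n)"
      by (simp add: consistent_def)
    then show "\<pi> (Suc n) = f (map \<pi> [0..<Suc n])"
      by (simp add: stretch_def)
  qed (fact that(1))
  ultimately show thesis
    using that f(2) by blast
qed

text \<open>Diamond picks a progressing successor, and at Box vertices every successor progresses.
  The measures along a consistent play thus satisfy \<open>progress_value_le\<close>, from every
  start vertex alike.\<close>

lemma progress_measure_strategy: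
  assumes \<rho>: "game_progress_measure G \<rho>"
  obtains \<sigma> where "strategy G Diamond \<sigma>" "positional \<sigma>"
    "\<And>\<pi>. play G \<pi> \<Longrightarrow> consistent \<sigma> \<pi> \<Longrightarrow> value_Diamond G \<pi> \<le> \<rho> (\<pi> 0)"
proof -
  obtain c where c: "\<And>v. v \<in> owned G Diamond \<Longrightarrow> c v \<in> succs G v"
    "\<And>v. v \<in> owned G Diamond \<Longrightarrow> progresses (prio G v) (\<rho> (c v)) (\<rho> v)"
    using \<rho> unfolding game_progress_measure_iff by metis
  define \<sigma> where
    "\<sigma> h = (if finite_path G h \<and> last h \<in> owned G Diamond then Some (c (last h)) else None)" for h
  have "strategy G Diamond \<sigma>"
    using c(1) by (auto simp: strategy_def \<sigma>_def split: if_splits)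
  moreover have "positional \<sigma>"
    by (auto simp: positional_def \<sigma>_def split: if_splits)
  moreover have "value_Diamond G \<pi> \<le> \<rho> (\<pi> 0)" if \<pi>: "play G \<pi>" "consistent \<sigma> \<pi>" for \<pi>
  proof (rule progress_value_le)
    fix n
    show "\<rho> (\<pi> n) \<in> ext_pmeasures G"
      using \<rho> play_verts[OF \<pi>(1)] pmeasures_subset unfolding game_progress_measure_iff by blast
    show "progresses (prio G (\<pi> n)) (\<rho> (\<pi> (Suc n))) (\<rho> (\<pi> n))"
    proof (cases "\<pi> n \<in> owned G Diamond")
      case True
      then have "\<sigma> (stretch \<pi> 0 n) = Some (c (\<pi> n))"
        using finite_path_stretch \<pi>(1) by (simp add: \<sigma>_def last_stretch)
      with \<pi>(2) have "\<pi> (Suc n) = c (\<pi> n)" by (simp add: consistent_def)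
      with c(2) True show ?thesis by simp
    next
      case False
      then have "\<pi> n \<in> owned G Box" using play_verts[OF \<pi>(1)] owned_verts by blast
      with \<rho> \<pi>(1) show ?thesis unfolding game_progress_measure_iff play_def by blast
    qed
  qed (fact \<pi>(1))
  ultimately show thesis by (rule that)
qed

end

theorem theorem3:
  fixes G :: "'v parity_game" and \<rho> :: "'v \<Rightarrow> pmeasure"
  assumes "parity_game G" and "least_game_progress_measure G \<rho>"
  shows "\<forall>v\<in>verts G.
    (\<exists>\<sigma>. strategy G Box \<sigma> \<and>
       (\<forall>\<pi>. play G \<pi> \<and> \<pi> 0 = v \<and> consistent \<sigma> \<pi> \<longrightarrow> value_Diamond G \<pi> \<ge> \<rho> v)) \<and>
    (\<exists>\<sigma>. strategy G Diamond \<sigma> \<and> positional \<sigma> \<and>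
       (\<forall>\<pi>. play G \<pi> \<and> \<pi> 0 = v \<and> consistent \<sigma> \<pi> \<longrightarrow> value_Diamond G \<pi> \<le> \<rho> v))"
proof (intro ballI conjI)
  interpret game G by standard (fact assms(1))
  fix v assume v: "v \<in> verts G"
  obtain \<mu> where \<mu>: "game_progress_measure G \<mu>"
    "forced v (\<lambda>\<pi>. \<mu> v \<le> value_Diamond G \<pi>)"
    using progress_measure_forced v by metis
  \<comment> \<open>Leastness places \<open>\<rho>\<close> below the progress measure that Box can
    force, so Box forces \<open>\<rho> v\<close> as well.\<close>
  have "\<rho> v \<le> \<mu> v"
    using assms(2) \<mu>(1) v by (simp add: least_game_progress_measure_def)
  then have "forced v (\<lambda>\<pi>. \<rho> v \<le> value_Diamond G \<pi>)"
    using \<mu>(2) by (elim forced_mono) (rule order_trans)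
  then show "\<exists>\<sigma>. strategy G Box \<sigma> \<and>
       (\<forall>\<pi>. play G \<pi> \<and> \<pi> 0 = v \<and> consistent \<sigma> \<pi> \<longrightarrow> value_Diamond G \<pi> \<ge> \<rho> v)"
    using forced_strategy by metis
  have "game_progress_measure G \<rho>"
    using assms(2) by (simp add: least_game_progress_measure_def)
  then show "\<exists>\<sigma>. strategy G Diamond \<sigma> \<and> positional \<sigma> \<and>
       (\<forall>\<pi>. play G \<pi> \<and> \<pi> 0 = v \<and> consistent \<sigma> \<pi> \<longrightarrow> value_Diamond G \<pi> \<le> \<rho> v)"
    using progress_measure_strategy by metis
qed

end
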